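(* Let $n\ge2$ be an integer, let $m\ge1/2$ be real, and define $$\Omega=\{z\in\mathbb C^n: |z_1|+|z_2|^{2m}+\dots+|z_n|^{2m}<1\}.$$ Then for $w=(b,0,\dots,0)$, where $0<b<1$, one has $$K_\Omega(w)\,\lambda(I^K_\Omega(w))=1+(1-b)^a\,\frac{(1+b)^a-(1-b)^a-2ab}{2ab(1+b)^a},$$ where $a=(n-1)/m+2$, $K_\Omega$ is the Bergman kernel of $\Omega$ on the diagonal and $I^K_\Omega(w)$ is the Kobayashi indicatrix of $\Omega$ at $w$.
   Context: $\lambda$ is Lebesgue measure on $\mathbb C^n\cong\mathbb R^{2n}$. The Bergman kernel on the diagonal is $$K_\Omega(w)=\sup\Big\{|f(w)|^2: f\in\mathcal O(\Omega),\ \int_\Omega|f|^2\,d\lambda\le1\Big\}.$$ With $\Delta$ the open unit disk in $\mathbb C$ and $\mathcal O(\Delta,\Omega)$ the set of holomorphic maps $\Delta\to\Omega$, the Kobayashi indicatrix is $$I^K_\Omega(w)=\{\varphi'(0): \varphi\in\mathcal O(\Delta,\Omega),\ \varphi(0)=w\}\subset\mathbb C^n.$$ *)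

theory Defs
  imports "HOL-Complex_Analysis.Complex_Analysis"
begin

text \<open>Complex Frechet differentiability at every point; intended for open \<open>\<Omega>\<close>.\<close>

definition holomorphic_functions :: "(complex ^ 'n) set \<Rightarrow> (complex ^ 'n \<Rightarrow> complex) set" where
  "holomorphic_functions \<Omega> =
     {f. \<forall>z\<in>\<Omega>. \<exists>D. (f has_derivative D) (at z) \<and> (\<forall>c v. D (c *s v) = c * D v)}"

text \<open>Taking values in \<^typ>\<open>ennreal\<close> makes the supremum meaningful even when it is infinite.
  The measure \<^term>\<open>lebesgue\<close> on \<^typ>\<open>complex ^ 'n\<close> is Lebesgue measure on the real Euclidean
  space of dimension twice the cardinality of \<^typ>\<open>'n\<close>.\<close>

definition bergman_kernel :: "(complex ^ 'n) set \<Rightarrow> complex ^ 'n \<Rightarrow> ennreal" where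
  "bergman_kernel \<Omega> w =
     (SUP f \<in> {f \<in> holomorphic_functions \<Omega>.
                 (\<integral>\<^sup>+z\<in>\<Omega>. ennreal ((norm (f z))\<^sup>2) \<partial>lebesgue) \<le> 1}.
        ennreal ((norm (f w))\<^sup>2))"

definition holomorphic_discs :: "(complex ^ 'n) set \<Rightarrow> (complex \<Rightarrow> complex ^ 'n) set" where
  "holomorphic_discs \<Omega> =
     {\<phi>. (\<forall>i. (\<lambda>\<zeta>. \<phi> \<zeta> $ i) holomorphic_on ball 0 1) \<and> \<phi> ` ball 0 1 \<subseteq> \<Omega>}"

definition kobayashi_indicatrix :: "(complex ^ 'n) set \<Rightarrow> complex ^ 'n \<Rightarrow> (complex ^ 'n) set" where
  "kobayashi_indicatrix \<Omega> w =
     {(\<chi> i. deriv (\<lambda>\<zeta>. \<phi> \<zeta> $ i) 0) | \<phi>. \<phi> \<in> holomorphic_discs \<Omega> \<and> \<phi> 0 = w}"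

text \<open>The index \<open>k\<close> plays the role of the first coordinate.\<close>

definition ellipsoid :: "'n \<Rightarrow> real \<Rightarrow> (complex ^ 'n) set" where
  "ellipsoid k m = {z. norm (z $ k) + (\<Sum>i\<in>UNIV - {k}. norm (z $ i) powr (2 * m)) < 1}"

end

theory Submission
  imports Defs
begin

text \<open>
  Write \<open>S z = (\<Sum>i\<noteq>k. \<bar>z\<^sub>i\<bar> powr (2 * m))\<close> and let \<open>C\<close> be the volume of \<open>{S \<le> 1}\<close> in the coordinates
  other than the \<open>k\<close>-th; then \<open>{S \<le> s}\<close> has volume \<open>C * s powr (a - 2)\<close>.

  For a disc \<open>\<phi>\<close> through \<open>w\<close> with derivative \<open>X\<close>, put \<open>h = \<phi>\<^sub>k\<close> and \<open>r = \<bar>X\<^sub>k\<bar>\<close>. Convexity of \<open>x powr (2 * m)\<close>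
  bounds \<open>S X\<close> by the circle mean of \<open>\<bar>1 - \<beta> z\<bar>\<^sup>2 * (1 - \<bar>h z\<bar>)\<close> for every \<open>0 \<le> \<beta> < 1\<close>, and Cauchy's formula
  bounds the mean of \<open>\<bar>1 - \<beta> z\<bar>\<^sup>2 * \<bar>h z\<bar>\<close> from below in terms of \<open>h 0\<close> and \<open>h' 0\<close>. The best \<open>\<beta>\<close> gives
  \<open>S X \<le> R r\<close> with an explicit \<open>R\<close>, and explicit discs attain every such \<open>X\<close>. Hence the indicatrix is
  \<open>{X. S X \<le> R \<bar>X\<^sub>k\<bar>}\<close>, of volume
  \<open>2 * pi * C * (\<integral>r. r * R r powr (a - 2)) = 2 * pi * C * (1 - b) powr a * (2 * a * b + (1 - b) powr a) / (a * (a - 1))\<close>.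

  The rotations of the coordinates preserve \<open>\<Omega>\<close>, so at points of the \<open>k\<close>-th axis only the powers of \<open>z\<^sub>k\<close>
  contribute to the Bergman kernel. They are orthogonal with squared norms \<open>2 * pi * C * Beta (2 * j + 2) (a - 1)\<close>,
  and the binomial series sums the kernel to
  \<open>(a - 1) / (4 * pi * b * C) * ((1 - b) powr (- a) - (1 + b) powr (- a))\<close>.
\<close>

subsection \<open>Lebesgue measure on products of complex lines\<close>

lemma measurable_vec_lambda_PiM [measurable]:
  "(\<lambda>f. \<chi> i. f i) \<in> (\<Pi>\<^sub>M i\<in>(UNIV::'n::finite set). (lborel::complex measure)) \<rightarrow>\<^sub>M borel"
proof (rule borel_measurable_euclidean_space[THEN iffD2], rule ballI)
  fix v :: "complex^'n" assume "v \<in> Basis"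
  then obtain i b where v: "v = axis i b" by (auto simp: Basis_vec_def)
  show "(\<lambda>f. (\<chi> i. f i) \<bullet> v) \<in> borel_measurable (\<Pi>\<^sub>M i\<in>(UNIV::'n::finite set). (lborel::complex measure))"
    unfolding v by (simp add: inner_axis)
qed

text \<open>The preimage of a box is a product of boxes, and the volumes of boxes determine Lebesgue
  measure. This lets Tonelli's theorem act on one complex coordinate at a time.\<close>

lemma lborel_vec_eq_distr_PiM:
  "lborel = distr (\<Pi>\<^sub>M i\<in>(UNIV::'n::finite set). (lborel::complex measure)) borel (\<lambda>f. \<chi> i. f i)"
proof (rule lborel_eqI)
  interpret product_sigma_finite "\<lambda>_::'n. lborel :: complex measure" ..
  fix l u :: "complex^'n"
  assume lu: "\<And>b. b \<in> Basis \<Longrightarrow> l \<bullet> b \<le> u \<bullet> b"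
  have lu': "b \<in> Basis \<Longrightarrow> l $ i \<bullet> b \<le> u $ i \<bullet> b" for i b
    using lu[of "axis i b"] by (auto simp: inner_axis axis_in_Basis_iff)
  have "(\<lambda>f. \<chi> i. f i) -` box l u \<inter> space (\<Pi>\<^sub>M i\<in>(UNIV::'n::finite set). (lborel::complex measure)) = (\<Pi>\<^sub>E i\<in>UNIV. box (l $ i) (u $ i))"
    by (fastforce simp: mem_box Basis_vec_def inner_axis space_PiM PiE_def Pi_iff)
  then have "emeasure (distr (\<Pi>\<^sub>M i\<in>(UNIV::'n::finite set). (lborel::complex measure)) borel (\<lambda>f. \<chi> i. f i)) (box l u)
    = (\<Prod>i\<in>UNIV. emeasure lborel (box (l $ i) (u $ i)))"
    by (simp add: emeasure_distr emeasure_PiM)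
  also have "\<dots> = (\<Prod>i\<in>UNIV. ennreal (\<Prod>b\<in>Basis. (u $ i - l $ i) \<bullet> b))"
    using lu' by (intro prod.cong) (auto simp: emeasure_lborel_box_eq)
  also have "\<dots> = ennreal (\<Prod>i\<in>UNIV. (\<Prod>b\<in>Basis. (u $ i - l $ i) \<bullet> b))"
    using lu' by (intro prod_ennreal) (auto intro!: prod_nonneg simp: inner_diff_left)
  also have "(\<Prod>i\<in>UNIV. (\<Prod>b\<in>Basis. (u $ i - l $ i) \<bullet> b)) = (\<Prod>b\<in>Basis. (u - l) \<bullet> b)"
  proof -
    have "Basis = (\<lambda>(i,b). axis i b :: complex^'n) ` (UNIV \<times> Basis)" by (auto simp: Basis_vec_def)
    moreover have "inj_on (\<lambda>(i,b). axis i b :: complex^'n) (UNIV \<times> Basis)"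
      by (auto simp: inj_on_def axis_eq_axis)
    ultimately have "(\<Prod>b\<in>Basis. (u - l) \<bullet> b) = (\<Prod>(i,b)\<in>UNIV\<times>Basis. (u - l) \<bullet> axis i b)"
      by (subst \<open>Basis = _\<close>, subst prod.reindex) (auto simp: case_prod_unfold intro!: prod.cong)
    also have "\<dots> = (\<Prod>i\<in>UNIV. (\<Prod>b\<in>Basis. (u $ i - l $ i) \<bullet> b))"
      by (subst prod.cartesian_product[symmetric]) (simp add: inner_axis)
    finally show ?thesis ..
  qed
  finally show "emeasure (distr (\<Pi>\<^sub>M i\<in>(UNIV::'n::finite set). (lborel::complex measure)) borel (\<lambda>f. \<chi> i. f i)) (box l u) = ennreal (\<Prod>b\<in>Basis. (u - l) \<bullet> b)" .
qed simp

text \<open>Transfers the plane to \<open>real^2\<close>, where the invariance of volume under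
  orthogonal transformations yields \<open>distr_complex_rotation\<close>.\<close>

lemma lborel_real2_complex:
  "lborel = distr (lborel :: (real^2) measure) borel (\<lambda>v. Complex (v $ 1) (v $ 2))"
proof (rule lborel_eqI)
  have [measurable]: "(\<lambda>v::real^2. Complex (v $ 1) (v $ 2)) \<in> borel_measurable borel"
    unfolding Complex_eq by (intro borel_measurable_continuous_onI continuous_intros)
  fix l u :: complex assume lu: "\<And>b. b \<in> Basis \<Longrightarrow> l \<bullet> b \<le> u \<bullet> b"
  let ?l = "vector [Re l, Im l] :: real^2" and ?u = "vector [Re u, Im u] :: real^2"
  have le: "Re l \<le> Re u" "Im l \<le> Im u" using lu[of 1] lu[of \<i>] by (auto simp: Basis_complex_def)
  have "(\<lambda>v::real^2. Complex (v $ 1) (v $ 2)) -` box l u = box ?l ?u"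
    by (auto simp: mem_box_cart mem_box Basis_complex_def forall_2)
  then have "emeasure (distr (lborel :: (real^2) measure) borel (\<lambda>v. Complex (v $ 1) (v $ 2))) (box l u) = emeasure lborel (box ?l ?u)"
    by (simp add: emeasure_distr)
  also have "\<dots> = ennreal (\<Prod>b\<in>Basis. (?u - ?l) \<bullet> b)"
    using le
  proof (subst emeasure_lborel_box)
    show "?l \<bullet> b \<le> ?u \<bullet> b" if b: "b \<in> Basis" for b
    proof -
      obtain i where "b = axis i 1" using b by (auto simp: Basis_vec_def)
      then show ?thesis using le exhaust_2[of i] by (auto simp: inner_axis)
    qed
  qed simp
  also have "(\<Prod>b\<in>Basis. (?u - ?l) \<bullet> b) = (\<Prod>i\<in>UNIV. (?u - ?l) $ i)"
    unfolding Basis_vec_def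
    by (rule prod.reindex_bij_witness[of _ "\<lambda>i. axis i 1" axis_index]) (auto simp: axis_index_axis inner_axis)
  also have "\<dots> = (\<Prod>b\<in>Basis. (u - l) \<bullet> b)"
    by (simp add: UNIV_2 Basis_complex_def)
  finally show "emeasure (distr (lborel :: (real^2) measure) borel (\<lambda>v. Complex (v $ 1) (v $ 2))) (box l u) = ennreal (\<Prod>b\<in>Basis. (u - l) \<bullet> b)" .
qed simp

lemma distr_complex_rotation:
  assumes c: "norm c = 1"
  shows "distr lborel borel ((*) c) = (lborel :: complex measure)"
proof (rule lborel_eqI[symmetric])
  fix l u :: complex assume lu: "\<And>b. b \<in> Basis \<Longrightarrow> l \<bullet> b \<le> u \<bullet> b"
  have [measurable]: "(\<lambda>v::real^2. Complex (v $ 1) (v $ 2)) \<in> borel_measurable borel"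
    unfolding Complex_eq by (intro borel_measurable_continuous_onI continuous_intros)
  have [measurable]: "(*) c -` box l u \<in> sets borel"
    by (rule measurable_sets_borel[of _ borel]) auto
  define \<psi> where "\<psi> = (\<lambda>v::real^2. Complex (v $ 1) (v $ 2))"
  have \<psi>: "lborel = distr lborel borel \<psi>" unfolding \<psi>_def by (rule lborel_real2_complex)
  have [measurable]: "\<psi> \<in> borel_measurable borel" unfolding \<psi>_def by simp
  \<comment> \<open>In real coordinates \<open>f\<close> is multiplication by \<open>cnj c\<close>,
    the inverse of the rotation because \<open>norm c = 1\<close>.\<close>
  define f where "f = (\<lambda>v::real^2. vector [Re c * v $ 1 + Im c * v $ 2, Re c * v $ 2 - Im c * v $ 1] :: real^2)"
  have cc: "Re c * Re c + Im c * Im c = 1" using c by (simp add: cmod_def power2_eq_square)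
  have "linear f"
    unfolding f_def by (rule linearI) (auto simp: vec_eq_iff forall_2 algebra_simps)
  moreover have "f v \<bullet> f w = v \<bullet> w" for v w
  proof -
    have "f v \<bullet> f w = (Re c * Re c + Im c * Im c) * (v \<bullet> w)"
      unfolding f_def inner_vec_def sum_2 by (simp add: algebra_simps)
    then show ?thesis using cc by simp
  qed
  ultimately have orth: "orthogonal_transformation f" by (simp add: orthogonal_transformation_def)
  have \<psi>f: "c * \<psi> (f v) = \<psi> v" for v
  proof -
    have "c * \<psi> (f v) = Complex ((Re c * Re c + Im c * Im c) * v $ 1) ((Re c * Re c + Im c * Im c) * v $ 2)"
      by (simp add: \<psi>_def f_def complex_eq_iff algebra_simps)
    then show ?thesis using cc by (simp add: \<psi>_def)
  qed
  let ?l = "vector [Re l, Im l] :: real^2" and ?u = "vector [Re u, Im u] :: real^2"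
  have box: "\<psi> -` box l u = box ?l ?u"
    by (auto simp: \<psi>_def mem_box_cart mem_box Basis_complex_def forall_2)
  have eq: "\<psi> -` ((*) c -` box l u) = f ` (\<psi> -` box l u)"
  proof (intro equalityI subsetI)
    fix v assume v: "v \<in> \<psi> -` ((*) c -` box l u)"
    obtain w where w: "v = f w"
      using orth orthogonal_transformation_surj[OF orth] by (metis surjD)
    show "v \<in> f ` (\<psi> -` box l u)" using v \<psi>f[of w] w by auto
  qed (use \<psi>f in auto)
  have "emeasure (distr lborel borel ((*) c)) (box l u) = emeasure (distr lborel borel \<psi>) ((*) c -` box l u)"
    by (simp add: emeasure_distr \<psi>[symmetric])
  also have "\<dots> = emeasure lborel (f ` box ?l ?u)"
    by (subst emeasure_distr) (auto simp: eq box)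
  also have "\<dots> = emeasure lebesgue (f ` box ?l ?u)"
  proof -
    have "\<psi> -` ((*) c -` box l u) \<in> sets borel" by (rule measurable_sets_borel[of _ borel]) auto
    then show ?thesis using eq box by simp
  qed
  also have "\<dots> = emeasure lebesgue (box ?l ?u)"
    using measure_orthogonal_image[OF orth, of "box ?l ?u"] measurable_orthogonal_image[OF orth, of "box ?l ?u"]
    by (simp add: emeasure_eq_measure2)
  also have "\<dots> = emeasure (distr lborel borel \<psi>) (box l u)"
    by (simp add: emeasure_distr box)
  also have "\<dots> = ennreal (\<Prod>b\<in>Basis. (u - l) \<bullet> b)"
    using lu by (simp add: \<psi>[symmetric] emeasure_lborel_box)
  finally show "emeasure (distr lborel borel ((*) c)) (box l u) = ennreal (\<Prod>b\<in>Basis. (u - l) \<bullet> b)" .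
qed simp

text \<open>Multiplication by \<open>c\<close> is a rotation, which preserves area, followed by the
  real dilation by \<open>norm c\<close>, which contributes the square since the plane has real
  dimension two.\<close>

lemma emeasure_vimage_complex_mult:
  assumes c: "c \<noteq> 0" and A: "A \<in> sets (borel :: complex measure)"
  shows "emeasure lborel A = ennreal ((norm c)\<^sup>2) * emeasure lborel ((*) c -` A)"
proof -
  have [measurable]: "A \<in> sets borel" by fact
  define r where "r = norm c"
  have r: "r > 0" using c by (simp add: r_def)
  have 1: "(*) (of_real r) -` A \<in> sets borel" by (rule measurable_sets_borel[of _ borel]) auto
  have m: "(\<lambda>z::complex. r *\<^sub>R z) \<in> borel_measurable borel" by simp
  have "emeasure lborel A = emeasure (density (distr lborel borel (\<lambda>x. 0 + r *\<^sub>R x)) (\<lambda>_. ennreal (\<bar>r\<bar>^DIM(complex)))) A"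
    by (subst lborel_affine[of r 0]) (use r in auto)
  also have "\<dots> = ennreal (r\<^sup>2) * emeasure (distr lborel borel (\<lambda>x. 0 + r *\<^sub>R x)) A"
    using r by (subst emeasure_density) (auto simp: nn_integral_cmult_indicator)
  also have "emeasure (distr lborel borel (\<lambda>x. 0 + r *\<^sub>R x)) A = emeasure lborel ((*) (of_real r) -` A)"
    by (simp add: emeasure_distr scaleR_conv_of_real vimage_def)
  also have "\<dots> = emeasure (distr lborel borel ((*) (c / r))) ((*) (of_real r) -` A)"
    using r by (subst distr_complex_rotation) (auto simp: norm_divide r_def)
  also have "\<dots> = emeasure lborel ((*) c -` A)"
    using 1 r by (subst emeasure_distr) (auto simp: vimage_def)
  finally show ?thesis by (simp add: r_def)
qed

text \<open>The scaled and reweighted measure \<open>?Q\<close> agrees with \<open>P\<close> on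
  product sets by the one-variable rule in each factor, hence everywhere. An arbitrary finite index
  set covers both the whole space and the coordinates other than \<open>k\<close>.\<close>

lemma emeasure_PiM_complex_mult:
  fixes c :: "'i \<Rightarrow> complex"
  assumes I: "finite I" and c: "\<And>i. i \<in> I \<Longrightarrow> c i \<noteq> 0"
  defines "P \<equiv> \<Pi>\<^sub>M i\<in>I. (lborel :: complex measure)"
  assumes A: "A \<in> sets P"
  shows "emeasure P A = ennreal (\<Prod>i\<in>I. (norm (c i))\<^sup>2) * emeasure P {f\<in>space P. (\<lambda>i\<in>I. c i * f i) \<in> A}"
proof -
  interpret product_sigma_finite "\<lambda>_::'i. lborel :: complex measure" ..
  let ?T = "\<lambda>f. \<lambda>i\<in>I. c i * f i"
  let ?Q = "density (distr P P ?T) (\<lambda>_. ennreal (\<Prod>i\<in>I. (norm (c i))\<^sup>2))"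
  have T[measurable]: "?T \<in> P \<rightarrow>\<^sub>M P" unfolding P_def by measurable
  have Q: "emeasure ?Q B = ennreal (\<Prod>i\<in>I. (norm (c i))\<^sup>2) * emeasure P {f\<in>space P. ?T f \<in> B}" if "B \<in> sets P" for B
    using that by (subst emeasure_density) (auto simp: nn_integral_cmult_indicator emeasure_distr vimage_def Int_def conj_commute)
  have "?Q = P" unfolding P_def
  proof (rule PiM_eqI[OF I])
    show "sets (density (distr (Pi\<^sub>M I (\<lambda>_. lborel)) (Pi\<^sub>M I (\<lambda>_. lborel)) ?T) (\<lambda>_. ennreal (\<Prod>i\<in>I. (norm (c i))\<^sup>2))) = sets (Pi\<^sub>M I (\<lambda>_. lborel))"
      by simp
    fix B :: "'i \<Rightarrow> complex set" assume B: "\<And>i. i \<in> I \<Longrightarrow> B i \<in> sets lborel"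
    have PB: "Pi\<^sub>E I B \<in> sets P" unfolding P_def using B I by (intro sets_PiM_I_finite) auto
    have eq: "{f\<in>space P. ?T f \<in> Pi\<^sub>E I B} = Pi\<^sub>E I (\<lambda>i. (*) (c i) -` B i)"
      by (auto simp: P_def space_PiM PiE_iff extensional_def)
    have B': "(*) (c i) -` B i \<in> sets borel" if "i \<in> I" for i
      using B[OF that] by (intro measurable_sets_borel[of _ borel]) auto
    have "emeasure ?Q (Pi\<^sub>E I B) = ennreal (\<Prod>i\<in>I. (norm (c i))\<^sup>2) * (\<Prod>i\<in>I. emeasure lborel ((*) (c i) -` B i))"
      unfolding Q[OF PB] eq unfolding P_def using B' I by (subst emeasure_PiM) auto
    also have "\<dots> = (\<Prod>i\<in>I. ennreal ((norm (c i))\<^sup>2) * emeasure lborel ((*) (c i) -` B i))"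
      by (simp add: prod.distrib prod_ennreal)
    also have "\<dots> = (\<Prod>i\<in>I. emeasure lborel (B i))"
      using c B by (intro prod.cong refl emeasure_vimage_complex_mult[symmetric]) auto
    finally show "emeasure (density (distr (Pi\<^sub>M I (\<lambda>_. lborel)) (Pi\<^sub>M I (\<lambda>_. lborel)) ?T) (\<lambda>_. ennreal (\<Prod>i\<in>I. (norm (c i))\<^sup>2))) (Pi\<^sub>E I B) =
      (\<Prod>i\<in>I. emeasure lborel (B i))" unfolding P_def .
  qed
  then show ?thesis using Q[OF A] by simp
qed

lemma distr_vec_rotation:
  fixes u :: "'n::finite \<Rightarrow> complex"
  assumes u: "\<And>i. norm (u i) = 1"
  shows "distr lborel borel (\<lambda>z. \<chi> i. u i * z $ i) = (lborel :: (complex^'n) measure)"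
proof (rule measure_eqI)
  fix A :: "(complex^'n) set" assume "A \<in> sets (distr lborel borel (\<lambda>z. \<chi> i. u i * z $ i))"
  then have A[measurable]: "A \<in> sets borel" by simp
  let ?P = "\<Pi>\<^sub>M i\<in>(UNIV::'n set). (lborel::complex measure)"
  let ?v = "\<lambda>f. (\<chi> i. f i) :: complex^'n"
  let ?T = "\<lambda>z. (\<chi> i. u i * z $ i) :: complex^'n"
  have T[measurable]: "?T \<in> borel_measurable borel"
    by (intro borel_measurable_continuous_onI continuous_intros)
  have [measurable]: "?T -` A \<in> sets borel" by (rule measurable_sets_borel[OF T A])
  have u0: "u i \<noteq> 0" for i using u[of i] by auto
  have "emeasure lborel A = emeasure ?P (?v -` A \<inter> space ?P)"
    by (subst lborel_vec_eq_distr_PiM) (simp add: emeasure_distr)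
  also have "\<dots> = emeasure ?P {f\<in>space ?P. (\<lambda>i\<in>UNIV. u i * f i) \<in> ?v -` A \<inter> space ?P}"
    by (subst emeasure_PiM_complex_mult[where c=u]) (auto simp: u u0 intro: measurable_sets)
  also have "{f\<in>space ?P. (\<lambda>i\<in>UNIV. u i * f i) \<in> ?v -` A \<inter> space ?P} = ?v -` (?T -` A) \<inter> space ?P"
    by (auto simp: space_PiM restrict_UNIV)
  also have "emeasure ?P \<dots> = emeasure lborel (?T -` A)"
    by (subst lborel_vec_eq_distr_PiM) (simp add: emeasure_distr)
  also have "\<dots> = emeasure (distr lborel borel ?T) A"
    by (simp add: emeasure_distr)
  finally show "emeasure (distr lborel borel ?T) A = emeasure lborel A" by simp
qed simp

section \<open>Volumes of power-sum balls in the coordinates other than \<open>k\<close>\<close>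

definition fibre_measure :: "'n::finite \<Rightarrow> ('n \<Rightarrow> complex) measure" where
  "fibre_measure k = (\<Pi>\<^sub>M i\<in>UNIV - {k}. lborel)"

definition power_sum :: "'n::finite \<Rightarrow> real \<Rightarrow> ('n \<Rightarrow> complex) \<Rightarrow> real" where
  "power_sum k p f = (\<Sum>i\<in>UNIV - {k}. norm (f i) powr p)"

lemma measurable_power_sum [measurable]: "power_sum k p \<in> borel_measurable (fibre_measure k)"
  unfolding power_sum_def fibre_measure_def by measurable

lemma measurable_power_sum_vec [measurable]: "(\<lambda>z. power_sum k p (($) z)) \<in> borel_measurable borel"
proof -
  have [measurable]: "(\<lambda>z::complex^'a. z $ i) \<in> borel_measurable borel" for i
    by (intro borel_measurable_continuous_onI continuous_intros)
  show ?thesis unfolding power_sum_def by measurable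
qed

text \<open>Tonelli's theorem with the coordinate \<open>k\<close> split off: points of the fibre
  are functions on \<open>UNIV - {k}\<close>, and inserting \<open>k\<close> recovers the full
  product. Both the volume of the indicatrix and the monomial norms have integrands of this
  form.\<close>

lemma nn_integral_coordinate_power_sum:
  fixes k :: "'n::finite" and G :: "complex \<Rightarrow> real \<Rightarrow> ennreal"
  assumes G [measurable]: "case_prod G \<in> borel_measurable (borel \<Otimes>\<^sub>M borel)"
  shows "(\<integral>\<^sup>+z. G (z $ k) (power_sum k p (($) z)) \<partial>lborel)
    = (\<integral>\<^sup>+u. (\<integral>\<^sup>+f. G u (power_sum k p f) \<partial>fibre_measure k) \<partial>lborel)"
proof -
  interpret product_sigma_finite "\<lambda>_::'n. lborel :: complex measure" ..
  let ?P = "\<Pi>\<^sub>M i\<in>(UNIV::'n set). (lborel::complex measure)"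
  have UN: "insert k (UNIV - {k}) = (UNIV::'n set)" by auto
  have [measurable]: "(\<lambda>z::complex^'n. z $ i) \<in> borel_measurable borel" for i
    by (intro borel_measurable_continuous_onI continuous_intros)
  have [measurable]: "power_sum k p \<in> borel_measurable ?P"
    unfolding power_sum_def by measurable
  have "(\<integral>\<^sup>+z. G (z $ k) (power_sum k p (($) z)) \<partial>lborel)
      = (\<integral>\<^sup>+f. G (f k) (power_sum k p f) \<partial>?P)"
    by (subst lborel_vec_eq_distr_PiM, subst nn_integral_distr) (simp_all add: power_sum_def)
  also have "\<dots> = (\<integral>\<^sup>+f. G (f k) (power_sum k p f) \<partial>(\<Pi>\<^sub>M i\<in>insert k (UNIV - {k}). (lborel::complex measure)))"
    by (simp add: UN)
  also have "\<dots> = (\<integral>\<^sup>+u. (\<integral>\<^sup>+f. G ((f(k:=u)) k) (power_sum k p (f(k:=u))) \<partial>(\<Pi>\<^sub>M i\<in>UNIV - {k}. lborel)) \<partial>lborel)"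
    by (rule product_nn_integral_insert_rev) (auto simp: UN)
  also have "\<dots> = (\<integral>\<^sup>+u. (\<integral>\<^sup>+f. G u (power_sum k p f) \<partial>fibre_measure k) \<partial>lborel)"
    by (simp add: fibre_measure_def power_sum_def)
  finally show ?thesis .
qed

definition fibre_volume :: "'n::finite \<Rightarrow> real \<Rightarrow> real \<Rightarrow> ennreal" where
  "fibre_volume k p s = emeasure (fibre_measure k) {f \<in> space (fibre_measure k). power_sum k p f \<le> s}"

text \<open>The dilation by \<open>c = s powr (1 / p)\<close> multiplies the power sum by
  \<open>s\<close> and the volume by \<open>c\<close> to the real dimension
  \<open>2 * (CARD('n) - 1)\<close>. A general Borel set \<open>B\<close> serves closed and open
  sublevel sets alike.\<close>

lemma emeasure_power_sum_scale:
  fixes k :: "'n::finite"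
  assumes s: "s > 0" and p: "p > 0" and [measurable]: "B \<in> sets borel"
  shows "emeasure (fibre_measure k) {f \<in> space (fibre_measure k). power_sum k p f \<in> B}
    = ennreal (s powr (2 * (real CARD('n) - 1) / p)) *
      emeasure (fibre_measure k) {f \<in> space (fibre_measure k). s * power_sum k p f \<in> B}"
proof -
  let ?M = "fibre_measure k" and ?I = "UNIV - {k}"
  define c where "c = s powr (1/p)"
  have c: "c > 0" using s by (simp add: c_def)
  have cp: "c powr p = s" using s p by (simp add: c_def powr_powr)
  let ?A = "{f \<in> space ?M. power_sum k p f \<in> B}"
  have A: "?A \<in> sets ?M" by measurable
  have "emeasure ?M ?A = ennreal (\<Prod>i\<in>?I. (norm (complex_of_real c))\<^sup>2) * emeasure ?M {f\<in>space ?M. (\<lambda>i\<in>?I. complex_of_real c * f i) \<in> ?A}"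
    unfolding fibre_measure_def
    by (rule emeasure_PiM_complex_mult) (use c A in \<open>auto simp: fibre_measure_def\<close>)
  also have "(\<Prod>i\<in>?I. (norm (complex_of_real c))\<^sup>2) = c ^ (2 * (CARD('n) - 1))"
    using c by (simp add: power_mult)
  also have "\<dots> = c powr (2 * (real CARD('n) - 1))"
    using c by (subst powr_realpow[symmetric]) (auto simp: of_nat_diff)
  also have "\<dots> = s powr (2 * (real CARD('n) - 1) / p)"
    using s p by (simp add: c_def powr_powr)
  also have "{f\<in>space ?M. (\<lambda>i\<in>?I. complex_of_real c * f i) \<in> ?A} = {f \<in> space ?M. s * power_sum k p f \<in> B}"
  proof -
    have "power_sum k p (\<lambda>i\<in>?I. complex_of_real c * f i) = s * power_sum k p f" for f :: "'n \<Rightarrow> complex"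
      using c cp by (simp add: power_sum_def norm_mult powr_mult sum_distrib_left)
    moreover have "(\<lambda>i\<in>?I. complex_of_real c * f i) \<in> space ?M" for f :: "'n \<Rightarrow> complex"
      by (simp add: fibre_measure_def space_PiM)
    ultimately show ?thesis by simp
  qed
  finally show ?thesis .
qed

lemma fibre_volume_scale:
  fixes k :: "'n::finite"
  assumes s: "s > 0" and p: "p > 0"
  shows "fibre_volume k p s = ennreal (s powr (2 * (real CARD('n) - 1) / p)) * fibre_volume k p 1"
proof -
  have "s * x \<le> s \<longleftrightarrow> x \<le> 1" for x using s mult_le_cancel_left_pos[of s x 1] by simp
  then show ?thesis
    using emeasure_power_sum_scale[OF assms, of "{..s}" k] by (simp add: fibre_volume_def)
qed

lemma power_sum_nonneg: "power_sum k p f \<ge> 0"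
  by (simp add: power_sum_def sum_nonneg)

lemma fibre_volume_neg: "s < 0 \<Longrightarrow> fibre_volume k p s = 0"
  unfolding fibre_volume_def using power_sum_nonneg[of k p]
  by (smt (verit, best) Collect_empty_eq emeasure_empty)

lemma measurable_fibre_volume:
  fixes k :: "'n::finite"
  assumes "p > 0"
  shows "fibre_volume k p \<in> borel_measurable borel"
proof -
  \<comment> \<open>The dilation requires \<open>s > 0\<close>, so the value at zero is kept as a
    constant of its own.\<close>
  have "fibre_volume k p = (\<lambda>s. if s < 0 then 0 else if s = 0 then fibre_volume k p 0
      else ennreal (s powr (2 * (real CARD('n) - 1) / p)) * fibre_volume k p 1)"
  proof
    fix s show "fibre_volume k p s = (if s < 0 then 0 else if s = 0 then fibre_volume k p 0
      else ennreal (s powr (2 * (real CARD('n) - 1) / p)) * fibre_volume k p 1)"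
    proof (cases "s > 0")
      case True
      then show ?thesis by (subst fibre_volume_scale) (use assms in auto)
    qed (simp add: fibre_volume_neg)
  qed
  also have "\<dots> \<in> borel_measurable borel" by measurable
  finally show ?thesis .
qed

text \<open>Each coordinate has modulus at most one, so the set lies in a product of closed unit
  discs.\<close>

lemma fibre_volume_finite:
  assumes "p > 0" shows "fibre_volume k p 1 < \<infinity>"
proof -
  interpret product_sigma_finite "\<lambda>_::'a. lborel :: complex measure" ..
  have "fibre_volume k p 1 \<le> emeasure (fibre_measure k) (Pi\<^sub>E (UNIV - {k}) (\<lambda>_. cball 0 1))"
    unfolding fibre_volume_def
  proof (rule emeasure_mono)
    show "{f \<in> space (fibre_measure k). power_sum k p f \<le> 1} \<subseteq> Pi\<^sub>E (UNIV - {k}) (\<lambda>_. cball 0 1)"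
    proof
      fix f assume "f \<in> {f \<in> space (fibre_measure k). power_sum k p f \<le> 1}"
      then have f: "f \<in> space (fibre_measure k)" "power_sum k p f \<le> 1" by auto
      have "norm (f i) \<le> 1" if "i \<in> UNIV - {k}" for i
      proof -
        have "norm (f i) powr p \<le> power_sum k p f"
          unfolding power_sum_def using that by (intro member_le_sum) auto
        then have *: "norm (f i) powr p \<le> 1" using f by simp
        show ?thesis
        proof (rule ccontr)
          assume "\<not> ?thesis"
          then have "norm (f i) powr p > 1" using assms by simp
          with * show False by simp
        qed
      qed
      then show "f \<in> Pi\<^sub>E (UNIV - {k}) (\<lambda>_. cball 0 1)" using f(1)
        by (auto simp: fibre_measure_def space_PiM PiE_iff)
    qed
    show "Pi\<^sub>E (UNIV - {k}) (\<lambda>_. cball 0 1) \<in> sets (fibre_measure k)"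
      unfolding fibre_measure_def by (intro sets_PiM_I_finite) auto
  qed
  also have "\<dots> < \<infinity>" unfolding fibre_measure_def
    by (subst emeasure_PiM) (auto simp: emeasure_cball power_less_top_ennreal)
  finally show ?thesis .
qed

lemma fibre_volume_pos:
  fixes k :: "'n::finite"
  assumes p: "p > 0" shows "fibre_volume k p 1 > 0"
proof -
  interpret product_sigma_finite "\<lambda>_::'n. lborel :: complex measure" ..
  \<comment> \<open>With this radius every coordinate contributes at most
    \<open>1 / CARD('n)\<close>, so a whole polydisc lies in the sublevel set.\<close>
  define e where "e = (1 / real CARD('n)) powr (1/p)"
  have e: "e > 0" and ep: "e powr p = 1 / real CARD('n)"
    using p by (simp_all add: e_def powr_powr)
  have "0 < emeasure (fibre_measure k) (Pi\<^sub>E (UNIV - {k}) (\<lambda>_. cball 0 e))"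
    unfolding fibre_measure_def
  proof (subst emeasure_PiM)
    have "emeasure lborel (cball (0::complex) e) \<noteq> 0"
      using e by (simp add: emeasure_cball unit_ball_vol_2)
    then show "0 < (\<Prod>i\<in>UNIV - {k}. emeasure lborel (cball (0::complex) e))"
      by (simp add: zero_less_iff_neq_zero)
  qed auto
  also have "\<dots> \<le> fibre_volume k p 1"
    unfolding fibre_volume_def
  proof (rule emeasure_mono)
    show "Pi\<^sub>E (UNIV - {k}) (\<lambda>_. cball 0 e) \<subseteq> {f \<in> space (fibre_measure k). power_sum k p f \<le> 1}"
    proof safe
      fix f :: "'n \<Rightarrow> complex" assume f: "f \<in> Pi\<^sub>E (UNIV - {k}) (\<lambda>_. cball 0 e)"
      show "f \<in> space (fibre_measure k)" using f by (auto simp: fibre_measure_def space_PiM PiE_iff)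
      have "power_sum k p f \<le> (\<Sum>i\<in>UNIV-{k}. e powr p)"
        unfolding power_sum_def using f p by (intro sum_mono powr_mono2) (auto simp: PiE_iff)
      also have "\<dots> \<le> (\<Sum>i\<in>(UNIV::'n set). e powr p)" by (rule sum_mono2) auto
      also have "\<dots> = 1" by (simp add: ep)
      finally show "power_sum k p f \<le> 1" .
    qed
  qed measurable
  finally show ?thesis .
qed

text \<open>The ellipsoid is cut out by a strict inequality and the indicatrix by a weak one. The
  closed set at level 1 lies in the open set at every level \<open>t > 1\<close>, which by scaling
  has \<open>t powr ?q\<close> times the volume of the open one at level 1; letting \<open>t\<close>
  decrease to 1 shows that the boundary is null.\<close>

lemma emeasure_power_sum_less:
  fixes k :: "'n::finite"
  assumes s: "s > 0" and p: "p > 0"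
  shows "emeasure (fibre_measure k) {f \<in> space (fibre_measure k). power_sum k p f < s}
    = ennreal (s powr (2 * (real CARD('n) - 1) / p)) * fibre_volume k p 1"
proof -
  let ?q = "2 * (real CARD('n) - 1) / p"
  let ?W = "\<lambda>s. emeasure (fibre_measure k) {f \<in> space (fibre_measure k). power_sum k p f < s}"
  have W: "?W s = ennreal (s powr ?q) * ?W 1"
  proof -
    have "s * x < s \<longleftrightarrow> x < 1" for x using s mult_less_cancel_left_pos[of s x 1] by simp
    then show ?thesis
      using emeasure_power_sum_scale[OF assms, of "{..<s}" k] by simp
  qed
  have le: "fibre_volume k p 1 \<le> ennreal (t powr ?q) * ?W 1" if "t > 1" for t
  proof -
    have "fibre_volume k p 1 \<le> ?W t"
      unfolding fibre_volume_def using that by (intro emeasure_mono) auto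
    also have "?W t = ennreal (t powr ?q) * ?W 1"
    proof -
      have "t * x < t \<longleftrightarrow> x < 1" for x using that mult_less_cancel_left_pos[of t x 1] by simp
      then show ?thesis
        using emeasure_power_sum_scale[OF _ p, of t "{..<t}" k] that by simp
    qed
    finally show ?thesis .
  qed
  have "((\<lambda>t. ennreal (t powr ?q) * ?W 1) \<longlongrightarrow> ennreal (1 powr ?q) * ?W 1) (at_right 1)"
  proof (intro tendsto_mult_ennreal tendsto_ennrealI tendsto_const)
    show "((\<lambda>t. t powr ?q) \<longlongrightarrow> 1 powr ?q) (at_right 1)"
      by (intro tendsto_powr tendsto_const tendsto_ident_at) auto
    have "?W 1 \<le> fibre_volume k p 1" unfolding fibre_volume_def by (intro emeasure_mono) auto
    then have "?W 1 \<noteq> \<infinity>" using fibre_volume_finite[OF p, of k] by (auto simp: top_unique)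
    then show "\<not> (ennreal (1 powr ?q) = 0 \<and> ?W 1 = \<infinity> \<or> ennreal (1 powr ?q) = \<infinity> \<and> ?W 1 = 0)" by auto
  qed
  moreover have "\<forall>\<^sub>F t in at_right 1. fibre_volume k p 1 \<le> ennreal (t powr ?q) * ?W 1"
    using le by (auto simp: eventually_at_right_field intro!: exI[of _ 2])
  ultimately have "fibre_volume k p 1 \<le> ennreal (1 powr ?q) * ?W 1"
    by (intro tendsto_lowerbound[where F="at_right (1::real)"]) auto
  moreover have "?W 1 \<le> fibre_volume k p 1" unfolding fibre_volume_def by (intro emeasure_mono) auto
  ultimately have "?W 1 = fibre_volume k p 1" by simp
  then show ?thesis using W by simp
qed

text \<open>Polar coordinates for radial integrands. The image of Lebesgue measure under
  \<open>norm\<close> has density \<open>2 * pi * r\<close>, because both measures give the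
  half-lines \<open>{..r}\<close> the area of a disc; \<open>max 0 r\<close> accounts for negative
  \<open>r\<close>.\<close>

lemma nn_integral_complex_radial:
  fixes F :: "real \<Rightarrow> ennreal"
  assumes [measurable]: "F \<in> borel_measurable borel"
  shows "(\<integral>\<^sup>+z. F (norm (z::complex)) \<partial>lborel) = (\<integral>\<^sup>+r. F r * ennreal (2 * pi * r) * indicator {0..} r \<partial>lborel)"
proof -
  let ?D = "density lborel (\<lambda>r. ennreal (2 * pi * r) * indicator {0..} r)"
  have D: "emeasure ?D {..r} = ennreal (pi * (max 0 r)\<^sup>2)" for r
  proof -
    have "((\<lambda>x. 2 * pi * x) has_integral (pi * (max 0 r)\<^sup>2 - pi * 0\<^sup>2)) {0..max 0 r}"
      by (rule fundamental_theorem_of_calculus)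
         (auto intro!: derivative_eq_intros simp flip: has_real_derivative_iff_has_vector_derivative)
    then have "(\<integral>\<^sup>+x. ennreal (2 * pi * x) * indicator {0..max 0 r} x \<partial>lborel) = ennreal (pi * (max 0 r)\<^sup>2)"
      using nn_integral_has_integral_lebesgue'[of "{0..max 0 r}" "\<lambda>x. 2 * pi * x"] by simp
    moreover have "(\<integral>\<^sup>+x. ennreal (2 * pi * x) * indicator {0..} x * indicator {..r} x \<partial>lborel) = (\<integral>\<^sup>+x. ennreal (2 * pi * x) * indicator {0..max 0 r} x \<partial>lborel)"
      by (intro nn_integral_cong) (auto simp: indicator_def)
    ultimately show ?thesis by (simp add: emeasure_density)
  qed
  have fin: "emeasure (distr lborel borel (norm :: complex \<Rightarrow> real)) {..real i} \<noteq> \<infinity>" for i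
    proof -
      have "emeasure (distr lborel borel (norm :: complex \<Rightarrow> real)) {..real i} = emeasure lborel (cball (0::complex) i)"
        by (auto simp: emeasure_distr cball_def vimage_def)
      then show ?thesis using emeasure_lborel_cball_finite[of "0::complex" "real i"] by simp
    qed
  have eq: "distr lborel borel (norm :: complex \<Rightarrow> real) = ?D"
  proof (rule measure_eqI_generator_eq[where E="range (\<lambda>r::real. {..r})" and \<Omega>=UNIV and A="\<lambda>n. {..real n}"])
    show "Int_stable (range (\<lambda>r::real. {..r}))" by (auto simp: Int_stable_def)
    show "emeasure (distr lborel borel (norm :: complex \<Rightarrow> real)) X = emeasure ?D X"
      if rng: "X \<in> range (\<lambda>r::real. {..r})" for X
    proof -
    obtain r where X: "X = {..r}" using rng by auto
    have "emeasure (distr lborel borel (norm :: complex \<Rightarrow> real)) X = emeasure lborel (cball (0::complex) r)"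
      by (auto simp: X emeasure_distr cball_def vimage_def)
    also have "\<dots> = ennreal (pi * (max 0 r)\<^sup>2)"
      by (cases "r \<ge> 0") (auto simp: emeasure_cball unit_ball_vol_2)
    finally show ?thesis
      using D by (simp add: X)
    qed
    show "sets (distr lborel borel (norm :: complex \<Rightarrow> real)) = sigma_sets UNIV (range atMost)"
      by (simp add: borel_eq_atMost)
    show "sets ?D = sigma_sets UNIV (range atMost)"
      by (simp add: borel_eq_atMost)
    show "(\<Union>i. {..real i}) = UNIV" by (auto intro: real_arch_simple)
  qed (use fin in auto)
  have "(\<integral>\<^sup>+z. F (norm (z::complex)) \<partial>lborel) = integral\<^sup>N (distr lborel borel (norm :: complex \<Rightarrow> real)) F"
    by (simp add: nn_integral_distr)
  also have "\<dots> = (\<integral>\<^sup>+r. F r * ennreal (2 * pi * r) * indicator {0..} r \<partial>lborel)"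
    unfolding eq by (subst nn_integral_density) (auto simp: mult_ac)
  finally show ?thesis .
qed

subsection \<open>Mean values on circles\<close>

text \<open>Cauchy's formula for the circle of radius \<open>r\<close>, parametrised over
  \<open>{0..1}\<close> so that integrals over the parameter are means and the factor
  \<open>2 * pi * \<i>\<close> cancels.\<close>

lemma has_integral_circle_coefficient:
  assumes f: "f holomorphic_on ball 0 R" and r: "0 < r" "r < R"
  shows "((\<lambda>t. f (of_real r * exp (2 * of_real pi * \<i> * of_real t)) / exp (2 * of_real pi * \<i> * of_real t) ^ j)
    has_integral (of_real r ^ j * (deriv ^^ j) f 0 / fact j)) {0..1}"
proof -
  let ?e = "\<lambda>t::real. exp (2 * of_real pi * \<i> * of_real t) :: complex"
  have "cball 0 r \<subseteq> ball (0::complex) R" using r by auto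
  then have "((\<lambda>u. f u / (u - 0) ^ Suc j) has_contour_integral ((2 * pi * \<i>) / fact j * (deriv ^^ j) f 0)) (circlepath 0 r)"
    using f r by (intro Cauchy_has_contour_integral_higher_derivative_circlepath)
       (auto intro: holomorphic_on_subset holomorphic_on_imp_continuous_on)
  then have "((\<lambda>t. f (r * ?e t) / (r * ?e t) ^ Suc j * (2 * pi * \<i> * r * ?e t))
     has_integral ((2 * pi * \<i>) / fact j * (deriv ^^ j) f 0)) {0..1}"
    unfolding has_contour_integral
    by (rule has_integral_eq[rotated])
       (simp only: vector_derivative_circlepath, simp add: circlepath)
  from has_integral_mult_right[OF this, of "of_real r ^ j / (2 * pi * \<i>)"]
  have *: "((\<lambda>t. of_real r ^ j / (2 * pi * \<i>) * (f (r * ?e t) / (r * ?e t) ^ Suc j * (2 * pi * \<i> * r * ?e t)))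
     has_integral of_real r ^ j / (2 * pi * \<i>) * ((2 * pi * \<i>) / fact j * (deriv ^^ j) f 0)) {0..1}" .
  have "of_real r ^ j / (2 * pi * \<i>) * (f (r * ?e t) / (r * ?e t) ^ Suc j * (2 * pi * \<i> * r * ?e t)) = f (r * ?e t) / ?e t ^ j" for t
  proof -
    have "c ^ j / K * (A / (c * E) ^ Suc j * (K * c * E)) = A / E ^ j" if "c \<noteq> 0" "K \<noteq> 0" "E \<noteq> 0" for c K A E :: complex
      using that by (simp add: power_mult_distrib)
    from this[of "of_real r" "2 * pi * \<i>"] r show ?thesis by simp
  qed
  moreover have "of_real r ^ j / K * (K / fact j * (deriv ^^ j) f 0) = of_real r ^ j * (deriv ^^ j) f 0 / fact j"
    if "K \<noteq> 0" for K
    using that by simp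
  from this[of "2 * pi * \<i>"] have "of_real r ^ j / (2 * pi * \<i>) * ((2 * pi * \<i>) / fact j * (deriv ^^ j) f 0) = of_real r ^ j * (deriv ^^ j) f 0 / fact j"
    by simp
  ultimately show ?thesis using * by (simp only:)
qed

text \<open>Convexity puts the power above its tangent on the open half-line. At
  \<open>x = 0\<close> the left-hand side is \<open>(1 - p) * c powr p\<close>, which is
  nonpositive.\<close>

lemma powr_tangent_le:
  fixes x c p :: real
  assumes "p \<ge> 1" "x \<ge> 0" "c > 0"
  shows "c powr p + p * c powr (p - 1) * (x - c) \<le> x powr p"
proof (cases "x = 0")
  case True
  have "c powr p = c powr (p - 1) * c" using assms by (simp add: powr_diff)
  then have "c powr p + p * c powr (p - 1) * (x - c) = (1 - p) * c powr p" using True by (simp add: algebra_simps)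
  then show ?thesis using assms True by (simp add: mult_nonpos_nonneg)
next
  case False
  have "p * c powr (p - 1) * (x - c) \<le> x powr p - c powr p"
  proof (rule convex_on_imp_above_tangent[OF powr_convex[OF assms(1)]])
    show "((\<lambda>x. x powr p) has_field_derivative p * c powr (p - 1)) (at c within {0<..})"
      using assms by (auto intro!: derivative_eq_intros)
  qed (use assms False in \<open>auto simp: interior_open\<close>)
  then show ?thesis by simp
qed

text \<open>Cauchy's formula bounds \<open>norm (deriv f 0)\<close> by the mean of
  \<open>norm f\<close>. Jensen's inequality raises this to the power \<open>p\<close>; it is
  obtained by integrating the tangent inequality at \<open>c = norm (deriv f 0)\<close>, hence the
  separate case of zero derivative.\<close>

lemma norm_deriv_powr_le_circle_mean:
  assumes f: "f holomorphic_on ball 0 R" and R: "1 < R" and p: "p \<ge> 1"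
  shows "norm (deriv f 0) powr p \<le> integral {0..1} (\<lambda>t. norm (f (exp (2 * of_real pi * \<i> * of_real t))) powr p)"
proof (cases "deriv f 0 = 0")
  case False
  let ?e = "\<lambda>t::real. exp (2 * of_real pi * \<i> * of_real t) :: complex"
  define c where "c = norm (deriv f 0)"
  have c: "c > 0" using False by (simp add: c_def)
  have fe: "continuous_on {0..1} (\<lambda>t. f (?e t))"
    by (rule continuous_on_compose2[OF holomorphic_on_imp_continuous_on[OF f]])
       (use R in \<open>auto intro!: continuous_intros\<close>)
  have i1: "(\<lambda>t. norm (f (?e t))) integrable_on {0..1}"
    by (intro integrable_continuous_real continuous_intros fe)
  have i2: "(\<lambda>t. norm (f (?e t)) powr p) integrable_on {0..1}"
    by (intro integrable_continuous_real continuous_on_powr' continuous_intros fe) (use p in auto)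
  have h: "((\<lambda>t. f (?e t) / ?e t) has_integral deriv f 0) {0..1}"
    using has_integral_circle_coefficient[OF f _ R, of 1] by simp
  have "c \<le> integral {0..1} (\<lambda>t. norm (f (?e t)))"
    unfolding c_def integral_unique[OF h, symmetric]
    by (rule integral_norm_bound_integral) (use h i1 in \<open>auto simp: norm_divide\<close>)
  then have "0 \<le> p * c powr (p - 1) * (integral {0..1} (\<lambda>t. norm (f (?e t))) - c)"
    using p by simp
  then have "c powr p \<le> c powr p + p * c powr (p - 1) * (integral {0..1} (\<lambda>t. norm (f (?e t))) - c)"
    by simp
  also have "\<dots> = integral {0..1} (\<lambda>t. c powr p + p * c powr (p - 1) * (norm (f (?e t)) - c))"
  proof -
    have "((\<lambda>t. c powr p + p * c powr (p - 1) * (norm (f (?e t)) - c)) has_integral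
      (1 - 0) *\<^sub>R c powr p + p * c powr (p - 1) * (integral {0..1} (\<lambda>t. norm (f (?e t))) - (1 - 0) *\<^sub>R c)) {0..1}"
      by (intro has_integral_add has_integral_mult_right has_integral_diff has_integral_const_real integrable_integral i1)
         (use has_integral_const_real[of _ 0 1] in auto)
    then show ?thesis by (simp add: integral_unique)
  qed
  also have "\<dots> \<le> integral {0..1} (\<lambda>t. norm (f (?e t)) powr p)"
    by (rule integral_le) (use c p in \<open>auto intro!: powr_tangent_le i2 integrable_continuous_real continuous_intros fe\<close>)
  finally show ?thesis by (simp add: c_def)
next
  case True
  have "continuous_on {0..1} (\<lambda>t. norm (f (exp (2 * of_real pi * \<i> * of_real t))) powr p)"
    by (intro continuous_on_powr' continuous_intros continuous_on_compose2[OF holomorphic_on_imp_continuous_on[OF f]])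
       (use R p in auto)
  then show ?thesis using True
    by (auto intro!: integral_nonneg integrable_continuous_real)
qed

section \<open>Upper bounds for discs holomorphic beyond the closed unit disc\<close>

context
  fixes h :: "complex \<Rightarrow> complex" and g :: "'i \<Rightarrow> complex \<Rightarrow> complex" and J :: "'i set" and R m b :: real
  assumes J: "finite J" and R: "R > 1" and m: "m \<ge> 1/2"
    and h: "h holomorphic_on ball 0 R" and g: "\<And>i. i \<in> J \<Longrightarrow> g i holomorphic_on ball 0 R"
    and g0: "\<And>i. i \<in> J \<Longrightarrow> g i 0 = 0" and h0: "h 0 = of_real b"
    and le: "\<And>z. norm z = 1 \<Longrightarrow> norm (h z) + (\<Sum>i\<in>J. norm (g i z) powr (2 * m)) \<le> 1"
begin

text \<open>The factor \<open>(1 - \<beta> z) powr (1 / m)\<close> turns the circle mean of \<open>norm (g i z) powr (2 * m)\<close> into one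
  with weight \<open>(norm (1 - \<beta> z))\<^sup>2\<close>, and it does not change the derivative at \<open>0\<close> since \<open>g i 0 = 0\<close>.\<close>

lemma sum_deriv_powr_le_weighted_mean:
  assumes \<beta>: "0 \<le> \<beta>" "\<beta> < 1"
  shows "(\<Sum>i\<in>J. norm (deriv (g i) 0) powr (2 * m)) \<le> 1 + \<beta>\<^sup>2 -
    integral {0..1} (\<lambda>t. norm (h (exp (2 * of_real pi * \<i> * of_real t)) * (1 - of_real \<beta> * exp (2 * of_real pi * \<i> * of_real t))\<^sup>2))"
proof -
  let ?e = "\<lambda>t::real. exp (2 * of_real pi * \<i> * of_real t) :: complex"
  \<comment> \<open>Within radius \<open>1 / \<beta>\<close> the factor \<open>1 - \<beta> z\<close>
    has positive real part, so its principal power is holomorphic there.\<close>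
  define R' where "R' = min R (if \<beta> = 0 then R else 1 / \<beta>)"
  have R': "R' > 1" using R \<beta> by (auto simp: R'_def)
  have sub: "ball 0 R' \<subseteq> ball (0::complex) R" by (auto simp: R'_def)
  have pos: "0 < Re (1 - of_real \<beta> * z)" if "z \<in> ball 0 R'" for z :: complex
  proof (cases "\<beta> = 0")
    case False
    have "\<beta> * Re z \<le> \<beta> * norm z" using \<beta> by (intro mult_left_mono complex_Re_le_cmod) auto
    also have "\<dots> < 1" using that \<beta> False by (auto simp: R'_def field_simps)
    finally show ?thesis by simp
  qed auto
  have nonpos: "1 - of_real \<beta> * z \<notin> \<real>\<^sub>\<le>\<^sub>0" if "z \<in> ball 0 R'" for z :: complex
    using pos[OF that] by (auto simp: complex_nonpos_Reals_iff)
  define G where "G = (\<lambda>i z. g i z * (1 - of_real \<beta> * z) powr of_real (1 / m))"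
  have Ghol: "G i holomorphic_on ball 0 R'" if "i \<in> J" for i
    unfolding G_def using holomorphic_on_subset[OF g[OF that] sub] nonpos
    by (intro holomorphic_intros) auto
  have G': "deriv (G i) 0 = deriv (g i) 0" if i: "i \<in> J" for i
  proof -
    have 1: "(g i has_field_derivative deriv (g i) 0) (at 0)"
      using g[OF i] R by (intro holomorphic_derivI[of _ "ball 0 R"]) auto
    obtain d where 2: "((\<lambda>z. (1 - complex_of_real \<beta> * z) powr of_real (1 / m)) has_field_derivative d) (at 0)"
    proof -
      have "(\<lambda>z. (1 - of_real \<beta> * z) powr of_real (1 / m)) holomorphic_on ball 0 R'"
        using nonpos by (intro holomorphic_intros) auto
      from that[OF holomorphic_derivI[OF this open_ball]] show ?thesis using R' by simp
    qed
    show ?thesis unfolding G_def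
      by (rule DERIV_imp_deriv) (use DERIV_mult[OF 1 2] g0[OF i] in simp)
  qed
  have Gn: "norm (G i z) powr (2 * m) = norm (g i z) powr (2 * m) * (norm (1 - of_real \<beta> * z))\<^sup>2" for i z
    using m by (simp add: G_def norm_mult powr_mult norm_powr_real_powr' powr_powr)
  have c: "continuous_on {0..1} (\<lambda>t. f (?e t))" if "f holomorphic_on ball 0 R'" for f
    by (rule continuous_on_compose2[OF holomorphic_on_imp_continuous_on[OF that]])
       (use R' in \<open>auto intro!: continuous_intros\<close>)
  have hc: "continuous_on {0..1} (\<lambda>t. h (?e t))" using c[of h] holomorphic_on_subset[OF h sub] by auto
  have Gc: "continuous_on {0..1} (\<lambda>t. norm (G i (?e t)) powr (2 * m))" if "i \<in> J" for i
    using m by (intro continuous_on_powr' continuous_intros c Ghol that) auto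
  have "(\<Sum>i\<in>J. norm (deriv (g i) 0) powr (2 * m)) \<le> (\<Sum>i\<in>J. integral {0..1} (\<lambda>t. norm (G i (?e t)) powr (2 * m)))"
    using m R' Ghol by (intro sum_mono) (auto simp flip: G' intro!: norm_deriv_powr_le_circle_mean)
  also have "\<dots> = integral {0..1} (\<lambda>t. \<Sum>i\<in>J. norm (G i (?e t)) powr (2 * m))"
    using J by (intro integral_sum[symmetric] integrable_continuous_real Gc)
  also have "\<dots> \<le> integral {0..1} (\<lambda>t. (norm (1 - of_real \<beta> * ?e t))\<^sup>2 - norm (h (?e t) * (1 - of_real \<beta> * ?e t)\<^sup>2))"
  proof (rule integral_le)
    fix t :: real
    have n: "norm (?e t) = 1" by simp
    have "(\<Sum>i\<in>J. norm (g i (?e t)) powr (2 * m)) \<le> 1 - norm (h (?e t))" using le[OF n] by simp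
    then have "(\<Sum>i\<in>J. norm (g i (?e t)) powr (2 * m)) * (norm (1 - of_real \<beta> * ?e t))\<^sup>2 \<le> (1 - norm (h (?e t))) * (norm (1 - of_real \<beta> * ?e t))\<^sup>2"
      by (intro mult_right_mono) auto
    then show "(\<Sum>i\<in>J. norm (G i (?e t)) powr (2 * m)) \<le> (norm (1 - of_real \<beta> * ?e t))\<^sup>2 - norm (h (?e t) * (1 - of_real \<beta> * ?e t)\<^sup>2)"
      by (simp only: Gn sum_distrib_right[symmetric] norm_mult norm_power left_diff_distrib mult_1)
  qed (auto intro!: integrable_continuous_real continuous_intros Gc hc J)
  also have "\<dots> = integral {0..1} (\<lambda>t. (norm (1 - of_real \<beta> * ?e t))\<^sup>2) - integral {0..1} (\<lambda>t. norm (h (?e t) * (1 - of_real \<beta> * ?e t)\<^sup>2))"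
    by (intro integral_diff integrable_continuous_real continuous_intros hc)
  \<comment> \<open>Expanding the square leaves a multiple of \<open>Re (?e t)\<close>, whose mean
    is zero.\<close>
  also have "integral {0..1} (\<lambda>t. (norm (1 - of_real \<beta> * ?e t))\<^sup>2) = 1 + \<beta>\<^sup>2"
  proof -
    have eq: "(norm (1 - of_real \<beta> * ?e t))\<^sup>2 = 1 + \<beta>\<^sup>2 - 2 * \<beta> * Re (?e t)" for t
    proof -
      have "(norm (1 - of_real \<beta> * ?e t))\<^sup>2 = 1 + \<beta>\<^sup>2 * ((Re (?e t))\<^sup>2 + (Im (?e t))\<^sup>2) - 2 * \<beta> * Re (?e t)"
        unfolding cmod_power2 by (simp add: power2_eq_square algebra_simps)
      also have "(Re (?e t))\<^sup>2 + (Im (?e t))\<^sup>2 = 1" by (simp flip: cmod_power2)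
      finally show ?thesis by simp
    qed
    have "((\<lambda>t. ?e t) has_integral 0) {0..1}"
      using has_integral_circle_coefficient[of "\<lambda>z. z" 2 1 0] by simp
    from has_integral_Re[OF this] have re: "((\<lambda>t. Re (?e t)) has_integral 0) {0..1}"
      by (simp only: zero_complex.sel)
    have c1: "((\<lambda>t::real. 1 + \<beta>\<^sup>2) has_integral (1 + \<beta>\<^sup>2)) {0..1}"
      using has_integral_const_real[of "1 + \<beta>\<^sup>2" 0 1] by simp
    have "((\<lambda>t. 1 + \<beta>\<^sup>2 - 2 * \<beta> * Re (?e t)) has_integral (1 + \<beta>\<^sup>2 - 2 * \<beta> * 0)) {0..1}"
      by (rule has_integral_diff[OF c1 has_integral_mult_right[OF re]])
    then have "integral {0..1} (\<lambda>t. 1 + \<beta>\<^sup>2 - 2 * \<beta> * Re (?e t)) = 1 + \<beta>\<^sup>2"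
      by (simp only: integral_unique mult_zero_right diff_zero)
    then show ?thesis by (simp only: eq)
  qed
  finally show ?thesis .
qed

text \<open>The choice \<beta> = b. The mean of the modulus of
  \<open>F z = h z * (1 - b * z)\<^sup>2\<close> is at least \<open>norm (deriv F 0)\<close>, and
  \<open>h 0 = b\<close> makes this derivative \<open>deriv h 0 - 2 * b\<^sup>2\<close>. This is the
  sharp bound when \<open>deriv h 0\<close> is large.\<close>

lemma sum_deriv_powr_le_outer:
  assumes b: "0 \<le> b" "b < 1"
  shows "(\<Sum>i\<in>J. norm (deriv (g i) 0) powr (2 * m)) \<le> 1 + b\<^sup>2 - norm (deriv h 0 - of_real (2 * b\<^sup>2))"
proof -
  let ?e = "\<lambda>t::real. exp (2 * of_real pi * \<i> * of_real t) :: complex"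
  define F where "F = (\<lambda>z. h z * (1 - of_real b * z)\<^sup>2)"
  have F: "F holomorphic_on ball 0 R" unfolding F_def by (intro holomorphic_intros h)
  have hd: "(h has_field_derivative deriv h 0) (at 0)"
    using h R by (intro holomorphic_derivI[of _ "ball 0 R"]) auto
  have "deriv F 0 = deriv h 0 - of_real (2 * b\<^sup>2)"
    unfolding F_def by (rule DERIV_imp_deriv) (auto intro!: derivative_eq_intros hd simp: h0 power2_eq_square)
  moreover have "norm (deriv F 0) \<le> integral {0..1} (\<lambda>t. norm (F (?e t)))"
    using norm_deriv_powr_le_circle_mean[OF F R, of 1] by simp
  ultimately show ?thesis
    using sum_deriv_powr_le_weighted_mean[OF b] by (simp add: F_def)
qed

text \<open>Here \<open>\<beta> = b * \<alpha>\<close>. On the unit circle \<open>norm (1 - \<alpha> / z) = norm (1 - \<alpha> z)\<close>, so the mean of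
  \<open>norm (h z * (1 - \<beta> z)\<^sup>2)\<close> dominates the linear functional \<open>F 0 - \<alpha> * deriv F 0\<close> of
  \<open>F z = h z * (1 - \<beta> z)\<^sup>2 / (1 - \<alpha> z)\<close>.\<close>

lemma sum_deriv_powr_le_inner:
  assumes b: "0 \<le> b" "b < 1" and \<alpha>: "0 \<le> \<alpha>" "\<alpha> < 1"
  shows "(\<Sum>i\<in>J. norm (deriv (g i) 0) powr (2 * m)) \<le> 1 - b + b * (1 - b) * \<alpha>\<^sup>2 + \<alpha> * Re (deriv h 0)"
proof -
  let ?e = "\<lambda>t::real. exp (2 * of_real pi * \<i> * of_real t) :: complex"
  define \<beta> where "\<beta> = b * \<alpha>"
  have \<beta>: "0 \<le> \<beta>" "\<beta> < 1" using b \<alpha> mult_left_mono[of \<alpha> 1 b] by (auto simp: \<beta>_def)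
  \<comment> \<open>Keeps the pole of \<open>F\<close> at \<open>1 / \<alpha>\<close> outside the
    disc while the unit circle stays inside.\<close>
  define R' where "R' = min R (if \<alpha> = 0 then R else 1 / \<alpha>)"
  have R': "R' > 1" using R \<alpha> by (auto simp: R'_def)
  have sub: "ball 0 R' \<subseteq> ball (0::complex) R" by (auto simp: R'_def)
  have nz: "1 - of_real \<alpha> * z \<noteq> 0" if "z \<in> ball 0 R'" for z :: complex
  proof
    assume "1 - of_real \<alpha> * z = 0"
    then have "of_real \<alpha> * z = 1" by simp
    then have "\<alpha> * norm z = 1" using \<alpha> by (metis abs_of_nonneg norm_mult norm_of_real norm_one)
    moreover have "\<alpha> * norm z < 1" using that \<alpha> by (auto simp: R'_def field_simps split: if_splits)
    ultimately show False by simp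
  qed
  define F where "F = (\<lambda>z. h z * (1 - of_real \<beta> * z)\<^sup>2 / (1 - of_real \<alpha> * z))"
  have F: "F holomorphic_on ball 0 R'" unfolding F_def
    by (intro holomorphic_intros holomorphic_on_subset[OF h sub]) (use nz in auto)
  have hd: "(h has_field_derivative deriv h 0) (at 0)"
    using h R by (intro holomorphic_derivI[of _ "ball 0 R"]) auto
  have F': "deriv F 0 = deriv h 0 - of_real (2 * \<beta> * b) + of_real (\<alpha> * b)"
    unfolding F_def by (rule DERIV_imp_deriv) (auto intro!: derivative_eq_intros hd simp: h0)
  have i0: "((\<lambda>t. F (?e t)) has_integral F 0) {0..1}"
    using has_integral_circle_coefficient[OF F _ R', of 0] by simp
  have i1: "((\<lambda>t. F (?e t) / ?e t) has_integral deriv F 0) {0..1}"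
    using has_integral_circle_coefficient[OF F _ R', of 1] by simp
  have i: "((\<lambda>t. F (?e t) - of_real \<alpha> * (F (?e t) / ?e t)) has_integral F 0 - of_real \<alpha> * deriv F 0) {0..1}"
    by (intro has_integral_diff has_integral_mult_right i0 i1)
  have hc: "continuous_on {0..1} (\<lambda>t. h (?e t))"
    by (rule continuous_on_compose2[OF holomorphic_on_imp_continuous_on[OF h]])
       (use R in \<open>auto intro!: continuous_intros\<close>)
  have "b - \<alpha> * Re (deriv F 0) = Re (F 0 - of_real \<alpha> * deriv F 0)"
    by (simp add: F_def h0)
  also have "\<dots> \<le> norm (F 0 - of_real \<alpha> * deriv F 0)" by (rule complex_Re_le_cmod)
  also have "\<dots> \<le> integral {0..1} (\<lambda>t. norm (h (?e t) * (1 - of_real \<beta> * ?e t)\<^sup>2))"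
    unfolding integral_unique[OF i, symmetric]
  proof (rule integral_norm_bound_integral)
    show "(\<lambda>t. norm (h (?e t) * (1 - of_real \<beta> * ?e t)\<^sup>2)) integrable_on {0..1}"
      by (intro integrable_continuous_real continuous_intros hc)
    show "norm (F (?e t) - of_real \<alpha> * (F (?e t) / ?e t)) \<le> norm (h (?e t) * (1 - of_real \<beta> * ?e t)\<^sup>2)" for t
    proof -
      have e: "?e t * cnj (?e t) = 1" by (simp add: complex_norm_square[symmetric])
      then have "inverse (?e t) = cnj (?e t)" by (metis inverse_unique)
      \<comment> \<open>Dividing by \<open>?e t\<close> is multiplying by its conjugate, so the
        integrand is \<open>F\<close> times \<open>1 - \<alpha> * cnj (?e t)\<close>, whose modulus
        cancels the denominator of \<open>F\<close>.\<close>
      then have "norm (F (?e t) - of_real \<alpha> * (F (?e t) / ?e t)) = norm (F (?e t)) * norm (1 - of_real \<alpha> * cnj (?e t))"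
        by (simp add: divide_inverse algebra_simps flip: norm_mult)
      also have "norm (1 - of_real \<alpha> * cnj (?e t)) = norm (1 - of_real \<alpha> * ?e t)"
        using complex_mod_cnj[of "1 - of_real \<alpha> * ?e t"] by simp
      also have "norm (F (?e t)) * norm (1 - of_real \<alpha> * ?e t) = norm (h (?e t) * (1 - of_real \<beta> * ?e t)\<^sup>2)"
        using nz[of "?e t"] R' by (simp add: F_def norm_mult norm_divide)
      finally show ?thesis by simp
    qed
  qed (use i in auto)
  finally have "(\<Sum>i\<in>J. norm (deriv (g i) 0) powr (2 * m)) \<le> 1 + \<beta>\<^sup>2 - (b - \<alpha> * Re (deriv F 0))"
    using sum_deriv_powr_le_weighted_mean[OF \<beta>] by simp
  also have "\<dots> = 1 - b + b * (1 - b) * \<alpha>\<^sup>2 + \<alpha> * Re (deriv h 0)"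
    by (simp add: F' \<beta>_def power2_eq_square algebra_simps)
  finally show ?thesis .
qed

end

subsection \<open>The Kobayashi indicatrix\<close>

text \<open>The value at \<open>r\<close> is the supremum of \<open>power_sum k (2 * m)\<close> over the derivatives of discs
  whose \<open>k\<close>-th component has derivative of modulus \<open>r\<close>; the two cases are the geodesics whose
  \<open>k\<close>-th component omits zero in the disc, respectively has a zero there.\<close>

definition indicatrix_profile :: "real \<Rightarrow> real \<Rightarrow> real" where
  "indicatrix_profile b r = (if r \<le> 2 * b * (1 - b) then 1 - b - r\<^sup>2 / (4 * b * (1 - b)) else 1 - b\<^sup>2 - r)"

lemma in_ellipsoid_iff: "z \<in> ellipsoid k m \<longleftrightarrow> norm (z $ k) + power_sum k (2 * m) (($) z) < 1"
  by (simp add: ellipsoid_def power_sum_def)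

text \<open>Rotating the disc makes \<open>deriv h 0\<close> a nonpositive real. Among values of a
  given modulus this is where the inner and outer bounds are strongest.\<close>

lemma exists_rotation_to_neg_norm:
  obtains u :: complex where "norm u = 1" "u * x = - of_real (norm x)"
proof (cases "x = 0")
  case False
  then show ?thesis
    by (intro that[of "- cnj x / of_real (norm x)"])
       (auto simp: norm_divide mult.commute[of "cnj x"] complex_norm_square[symmetric] power2_eq_square)
qed (use that[of 1] in auto)

text \<open>A disc need not extend to the unit circle, so the bounds are applied to the discs
  rotated by \<open>u\<close> and dilated by \<open>\<rho> < 1\<close>, and then
  \<open>\<rho>\<close> tends to 1. The outer bound gives the linear branch of the profile, the
  inner one the quadratic branch.\<close>

lemma power_sum_deriv_le_profile:
  fixes \<phi> :: "complex \<Rightarrow> complex ^ 'n::finite"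
  assumes m: "m \<ge> 1/2" and b: "0 < b" "b < 1"
    and \<phi>: "\<phi> \<in> holomorphic_discs (ellipsoid k m)" and \<phi>0: "\<phi> 0 = axis k (of_real b)"
  shows "power_sum k (2 * m) (\<lambda>i. deriv (\<lambda>z. \<phi> z $ i) 0) \<le> indicatrix_profile b (norm (deriv (\<lambda>z. \<phi> z $ k) 0))"
proof -
  define X where "X = (\<lambda>i. deriv (\<lambda>z. \<phi> z $ i) 0)"
  define S where "S = power_sum k (2 * m) X"
  define r where "r = norm (X k)"
  obtain u where u: "norm u = 1" "u * X k = - of_real r"
    using exists_rotation_to_neg_norm[of "X k"] unfolding r_def by blast
  have hol: "(\<lambda>z. \<phi> z $ i) holomorphic_on ball 0 1" for i
    using \<phi> by (auto simp: holomorphic_discs_def)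
  have ell: "norm (\<phi> z $ k) + power_sum k (2 * m) (($) (\<phi> z)) < 1" if "norm z < 1" for z
  proof -
    have "\<phi> z \<in> ellipsoid k m" using \<phi> that by (auto simp: holomorphic_discs_def)
    then show ?thesis by (simp add: in_ellipsoid_iff)
  qed
  define g where "g = (\<lambda>\<rho> i z. \<phi> (of_real \<rho> * u * z) $ i)"
  have small: "norm (of_real \<rho> * u * z) < 1" if "0 < \<rho>" "z \<in> ball 0 (1 / \<rho>)" for \<rho> z
    using that u by (simp add: norm_mult field_simps)
  have ghol: "g \<rho> i holomorphic_on ball 0 (1 / \<rho>)" if "0 < \<rho>" for \<rho> i
  proof -
    have "(\<lambda>z. \<phi> z $ i) \<circ> (\<lambda>z. of_real \<rho> * u * z) holomorphic_on ball 0 (1 / \<rho>)"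
      by (rule holomorphic_on_compose_gen[OF _ hol]) (auto intro!: holomorphic_intros small simp: that)
    then show ?thesis by (simp add: g_def comp_def)
  qed
  have g0: "g \<rho> i 0 = (if i = k then of_real b else 0)" for \<rho> i
    by (simp add: g_def \<phi>0 axis_def)
  have gd: "deriv (g \<rho> i) 0 = of_real \<rho> * u * X i" for \<rho> i
  proof -
    have 1: "((\<lambda>z. \<phi> z $ i) has_field_derivative X i) (at (of_real \<rho> * u * 0))"
      unfolding X_def using hol[of i] holomorphic_derivI[of _ "ball 0 1" 0] by simp
    have 2: "((\<lambda>z. of_real \<rho> * u * z) has_field_derivative of_real \<rho> * u) (at 0)"
      by (auto intro!: derivative_eq_intros)
    show ?thesis unfolding g_def
      by (rule DERIV_imp_deriv) (use DERIV_chain2[OF 1 2] in \<open>simp add: mult.commute\<close>)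
  qed
  have dk: "deriv (g \<rho> k) 0 = of_real (- \<rho> * r)" for \<rho>
    using u by (simp add: gd mult.assoc)
  have le1: "norm (g \<rho> k z) + (\<Sum>i\<in>UNIV - {k}. norm (g \<rho> i z) powr (2 * m)) \<le> 1"
    if "0 < \<rho>" "\<rho> < 1" "norm z = 1" for \<rho> z
    using ell[of "of_real \<rho> * u * z"] that u by (simp add: g_def power_sum_def norm_mult)
  have sum: "(\<Sum>i\<in>UNIV - {k}. norm (deriv (g \<rho> i) 0) powr (2 * m)) = \<rho> powr (2 * m) * S" if "0 < \<rho>" for \<rho>
    using that u by (simp add: gd norm_mult S_def power_sum_def powr_mult sum_distrib_left)
  \<comment> \<open>Passage to the limit, stated for affine right-hand sides because both bounds
    take that shape in \<open>\<rho>\<close>.\<close>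
  have lim: "S \<le> c + d" if "\<And>\<rho>. 0 < \<rho> \<Longrightarrow> \<rho> < 1 \<Longrightarrow> \<rho> powr (2 * m) * S \<le> c + \<rho> * d" for c d
  proof -
    have "1 powr (2 * m) * S \<le> c + 1 * d"
    proof (rule tendsto_le[where F="at_left (1::real)"])
      show "((\<lambda>\<rho>. c + \<rho> * d) \<longlongrightarrow> c + 1 * d) (at_left 1)"
        by (intro tendsto_intros)
      show "((\<lambda>\<rho>. \<rho> powr (2 * m) * S) \<longlongrightarrow> 1 powr (2 * m) * S) (at_left 1)"
        by (intro tendsto_intros) auto
      show "\<forall>\<^sub>F \<rho> in at_left 1. \<rho> powr (2 * m) * S \<le> c + \<rho> * d"
        unfolding eventually_at_left_field using that by (intro exI[of _ 0]) auto
    qed auto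
    then show ?thesis by simp
  qed
  have outer: "S \<le> 1 - b\<^sup>2 - r"
  proof -
    have "\<rho> powr (2 * m) * S \<le> (1 - b\<^sup>2) + \<rho> * (- r)" if \<rho>: "0 < \<rho>" "\<rho> < 1" for \<rho>
    proof -
      have "\<rho> powr (2 * m) * S \<le> 1 + b\<^sup>2 - norm (deriv (g \<rho> k) 0 - of_real (2 * b\<^sup>2))"
        unfolding sum[OF \<rho>(1), symmetric]
        by (rule sum_deriv_powr_le_outer[where R="1/\<rho>"]) (use \<rho> m b ghol g0 le1 in auto)
      also have "norm (deriv (g \<rho> k) 0 - of_real (2 * b\<^sup>2)) = \<rho> * r + 2 * b\<^sup>2"
      proof -
        have "deriv (g \<rho> k) 0 - of_real (2 * b\<^sup>2) = - of_real (\<rho> * r + 2 * b\<^sup>2)" by (simp add: dk)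
        then have "norm (deriv (g \<rho> k) 0 - of_real (2 * b\<^sup>2)) = \<bar>\<rho> * r + 2 * b\<^sup>2\<bar>"
          by (simp only: norm_minus_cancel norm_of_real)
        then show ?thesis using \<rho> by (simp add: r_def)
      qed
      finally show ?thesis by simp
    qed
    from lim[OF this] show ?thesis by simp
  qed
  have inner: "S \<le> 1 - b + b * (1 - b) * \<alpha>\<^sup>2 - \<alpha> * r" if \<alpha>: "0 \<le> \<alpha>" "\<alpha> < 1" for \<alpha>
  proof -
    have "\<rho> powr (2 * m) * S \<le> (1 - b + b * (1 - b) * \<alpha>\<^sup>2) + \<rho> * (- \<alpha> * r)" if \<rho>: "0 < \<rho>" "\<rho> < 1" for \<rho>
    proof -
      have "\<rho> powr (2 * m) * S \<le> 1 - b + b * (1 - b) * \<alpha>\<^sup>2 + \<alpha> * Re (deriv (g \<rho> k) 0)"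
        unfolding sum[OF \<rho>(1), symmetric]
        by (rule sum_deriv_powr_le_inner[where R="1/\<rho>"]) (use \<rho> m b \<alpha> ghol g0 le1 in auto)
      then show ?thesis by (simp add: dk mult.left_commute)
    qed
    from lim[OF this] show ?thesis by simp
  qed
  have "S \<le> indicatrix_profile b r"
  proof (cases "r < 2 * b * (1 - b)")
    case True
    \<comment> \<open>This value minimises
      \<open>b * (1 - b) * \<alpha>\<^sup>2 - \<alpha> * r\<close>; it is below 1 exactly in the
      present case.\<close>
    define \<alpha> where "\<alpha> = r / (2 * b * (1 - b))"
    have r: "r = 2 * b * (1 - b) * \<alpha>" using b by (simp add: \<alpha>_def)
    have "0 \<le> \<alpha>" "\<alpha> < 1" using True b by (simp_all add: \<alpha>_def r_def)
    from inner[OF this] have "S \<le> 1 - b - b * (1 - b) * \<alpha>\<^sup>2"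
      by (simp add: r power2_eq_square algebra_simps)
    also have "b * (1 - b) * \<alpha>\<^sup>2 = r\<^sup>2 / (4 * b * (1 - b))"
    proof -
      have "r\<^sup>2 = (4 * b * (1 - b)) * (b * (1 - b) * \<alpha>\<^sup>2)"
        by (simp add: r power2_eq_square)
      then show ?thesis using b by simp
    qed
    finally show ?thesis using True by (simp add: indicatrix_profile_def)
  next
    case False
    \<comment> \<open>The two branches of the profile agree at the threshold, so the outer bound
      also settles the boundary value of \<open>r\<close>, where \<alpha> would be 1.\<close>
    have "1 - b - (2 * b * (1 - b))\<^sup>2 / (4 * b * (1 - b)) = 1 - b\<^sup>2 - 2 * b * (1 - b)"
      using b by (simp add: power2_eq_square field_simps)
    then show ?thesis using outer False
      by (cases "r = 2 * b * (1 - b)") (auto simp: indicatrix_profile_def)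
  qed
  then show ?thesis by (simp add: S_def r_def X_def)
qed

text \<open>Precomposing a disc with the rotation \<open>z \<mapsto> c * z\<close> keeps its centre
  and multiplies its derivative by \<open>c\<close>.\<close>

lemma kobayashi_indicatrix_rotate:
  assumes c: "norm c = 1" and X: "X \<in> kobayashi_indicatrix \<Omega> w"
  shows "c *s X \<in> kobayashi_indicatrix \<Omega> w"
proof -
  from X obtain \<phi> where \<phi>: "\<phi> \<in> holomorphic_discs \<Omega>" "\<phi> 0 = w" and X: "X = (\<chi> i. deriv (\<lambda>z. \<phi> z $ i) 0)"
    by (auto simp: kobayashi_indicatrix_def)
  have hol: "(\<lambda>z. \<phi> z $ i) holomorphic_on ball 0 1" for i
    using \<phi> by (auto simp: holomorphic_discs_def)
  have "(\<lambda>z. \<phi> (c * z)) \<in> holomorphic_discs \<Omega>"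
  proof -
    have "(\<lambda>z. \<phi> z $ i) \<circ> (\<lambda>z. c * z) holomorphic_on ball 0 1" for i
      by (rule holomorphic_on_compose_gen[OF _ hol]) (use c in \<open>auto simp: norm_mult intro!: holomorphic_intros\<close>)
    then have "(\<lambda>z. \<phi> (c * z) $ i) holomorphic_on ball 0 1" for i by (simp add: comp_def)
    then show ?thesis using \<phi> c by (auto simp: holomorphic_discs_def norm_mult)
  qed
  moreover have "deriv (\<lambda>z. \<phi> (c * z) $ i) 0 = c * X $ i" for i
  proof -
    have 1: "((\<lambda>z. \<phi> z $ i) has_field_derivative X $ i) (at (c * 0))"
      unfolding X using hol[of i] holomorphic_derivI[of _ "ball 0 1" 0] by simp
    have 2: "((\<lambda>z. c * z) has_field_derivative c) (at 0)"
      by (auto intro!: derivative_eq_intros)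
    show ?thesis
      by (rule DERIV_imp_deriv) (use DERIV_chain2[OF 1 2] in \<open>simp add: mult.commute\<close>)
  qed
  ultimately show ?thesis using \<phi>(2)
    by (auto simp: kobayashi_indicatrix_def vec_eq_iff intro!: exI[of _ "\<lambda>z. \<phi> (c * z)"])
qed

text \<open>The disc has \<open>k\<close>-th component \<open>h\<close> and remaining components
  \<open>X $ i * (z * q z)\<close>. Since \<open>q 0 = 1\<close> their derivatives at 0 are
  \<open>X $ i\<close>, and since \<open>norm (q z) powr (2 * m)\<close> is the inverse square of
  \<open>norm (1 - \<beta> z)\<close>, the hypothesis \<open>less\<close> is membership in the
  ellipsoid with denominators cleared.\<close>

lemma in_kobayashi_indicatrixI:
  fixes X :: "complex ^ 'n::finite"
  assumes m: "m \<ge> 1/2" and \<beta>: "0 \<le> \<beta>" "\<beta> < 1"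
    and h: "h holomorphic_on ball 0 1" "h 0 = of_real b" "deriv h 0 = X $ k"
    and less: "\<And>z. norm z < 1 \<Longrightarrow> norm (h z) * (norm (1 - of_real \<beta> * z))\<^sup>2
        + power_sum k (2 * m) (($) X) * norm z powr (2 * m) < (norm (1 - of_real \<beta> * z))\<^sup>2"
  shows "X \<in> kobayashi_indicatrix (ellipsoid k m) (axis k (of_real b))"
proof -
  define q where "q = (\<lambda>z. (1 - of_real \<beta> * z) powr of_real (- 1 / m) :: complex)"
  define \<phi> where "\<phi> = (\<lambda>z. (\<chi> i. if i = k then h z else X $ i * (z * q z)) :: complex ^ 'n)"
  have pos: "0 < Re (1 - of_real \<beta> * z)" if "norm z < 1" for z
  proof -
    have "\<beta> * Re z \<le> \<beta> * norm z" using \<beta> by (intro mult_left_mono complex_Re_le_cmod) auto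
    also have "\<dots> \<le> \<beta> * 1" using that \<beta> by (intro mult_left_mono) auto
    finally show ?thesis using \<beta> by simp
  qed
  have nonpos: "1 - of_real \<beta> * z \<notin> \<real>\<^sub>\<le>\<^sub>0" if "norm z < 1" for z :: complex
    using pos[OF that] by (auto simp: complex_nonpos_Reals_iff)
  have q: "q holomorphic_on ball 0 1"
    unfolding q_def using nonpos by (intro holomorphic_intros) auto
  have "q 0 = 1" by (simp add: q_def)
  have qd: "((\<lambda>z. z * q z) has_field_derivative 1) (at 0)"
  proof -
    have "(q has_field_derivative deriv q 0) (at 0)"
      using q by (intro holomorphic_derivI[of _ "ball 0 1"]) auto
    from DERIV_mult[OF DERIV_ident this] show ?thesis by (simp add: \<open>q 0 = 1\<close>)
  qed
  have "\<phi> \<in> holomorphic_discs (ellipsoid k m)"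
    unfolding holomorphic_discs_def
  proof (safe)
    fix i show "(\<lambda>z. \<phi> z $ i) holomorphic_on ball 0 1"
      by (cases "i = k") (auto simp: \<phi>_def intro!: holomorphic_intros h q)
  next
    fix z :: complex assume "z \<in> ball 0 1"
    then have z: "norm z < 1" by simp
    let ?d = "norm (1 - of_real \<beta> * z)"
    have d: "?d > 0" using pos[OF z] complex_Re_le_cmod[of "1 - of_real \<beta> * z"] by linarith
    have nq: "norm (z * q z) powr (2 * m) = norm z powr (2 * m) / ?d\<^sup>2"
    proof -
      have "norm (q z) = ?d powr (- 1 / m)" by (simp add: q_def norm_powr_real_powr')
      then have "norm (z * q z) powr (2 * m) = norm z powr (2 * m) * ?d powr (- 2)"
        using m by (simp add: norm_mult powr_mult powr_powr)
      also have "?d powr (- 2) = 1 / ?d\<^sup>2"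
        using d by (simp add: powr_minus divide_inverse)
      finally show ?thesis by simp
    qed
    have "power_sum k (2 * m) (($) (\<phi> z)) = power_sum k (2 * m) (($) X) * norm (z * q z) powr (2 * m)"
      by (simp add: power_sum_def \<phi>_def norm_mult[of "X $ _"] powr_mult sum_distrib_right)
    also have "\<dots> = power_sum k (2 * m) (($) X) * norm z powr (2 * m) / ?d\<^sup>2"
      unfolding nq by simp
    finally have "norm (\<phi> z $ k) + power_sum k (2 * m) (($) (\<phi> z)) =
       (norm (h z) * ?d\<^sup>2 + power_sum k (2 * m) (($) X) * norm z powr (2 * m)) / ?d\<^sup>2"
      using d by (simp add: \<phi>_def field_simps)
    also have "\<dots> < 1" using less[OF z] d by simp
    finally show "\<phi> z \<in> ellipsoid k m" by (simp add: in_ellipsoid_iff)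
  qed
  moreover have "\<phi> 0 = axis k (of_real b)" by (auto simp: \<phi>_def h axis_def vec_eq_iff)
  moreover have "deriv (\<lambda>z. \<phi> z $ i) 0 = X $ i" for i
  proof (cases "i = k")
    case False
    have "((\<lambda>z. X $ i * (z * q z)) has_field_derivative X $ i * 1) (at 0)"
      by (intro DERIV_cmult qd)
    then show ?thesis using False by (simp add: \<phi>_def DERIV_imp_deriv)
  qed (simp add: \<phi>_def h)
  ultimately show ?thesis
    by (auto simp: kobayashi_indicatrix_def vec_eq_iff intro!: exI[of _ \<phi>])
qed

lemma norm_one_minus_power2:
  "(norm (1 - of_real c * z))\<^sup>2 = 1 - 2 * c * Re z + c\<^sup>2 * (norm z)\<^sup>2" for z :: complex and c :: real
  unfolding cmod_power2 by (simp add: power2_eq_square algebra_simps)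

text \<open>The extremal discs have \<open>k\<close>-th component \<open>b * ((1 - \<alpha> z) / (1 - b * \<alpha> * z))\<^sup>2\<close> in the first case of the
  profile and \<open>b * (1 - t * z + z\<^sup>2) / (1 - b * z)\<^sup>2\<close> in the second; the other components are multiples
  of \<open>z / (1 - \<beta> z) powr (1 / m)\<close>.\<close>

lemma profile_in_kobayashi_indicatrix:
  fixes X :: "complex ^ 'n::finite"
  assumes m: "m \<ge> 1/2" and b: "0 < b" "b < 1" and r: "0 \<le> r" and Xk: "X $ k = - of_real r"
    and le: "power_sum k (2 * m) (($) X) \<le> indicatrix_profile b r"
  shows "X \<in> kobayashi_indicatrix (ellipsoid k m) (axis k (of_real b))"
proof -
  define S where "S = power_sum k (2 * m) (($) X)"
  have S: "0 \<le> S" by (simp add: S_def power_sum_nonneg)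
  have Sz: "S * norm z powr (2 * m) \<le> S" if "norm z < 1" for z :: complex
    using that S m by (intro mult_left_le powr_le1) auto
  have nz: "1 - of_real \<beta> * z \<noteq> 0" if "0 \<le> \<beta>" "\<beta> < 1" "norm z < 1" for \<beta> and z :: complex
  proof
    assume "1 - of_real \<beta> * z = 0"
    then have "norm (of_real \<beta> * z) = 1" by (metis eq_iff_diff_eq_0 norm_one)
    then have "\<beta> * norm z = 1" using that by (simp add: norm_mult)
    moreover have "\<beta> * norm z \<le> \<beta> * 1" using that by (intro mult_left_mono) auto
    ultimately show False using that by simp
  qed
  show ?thesis
  proof (cases "r \<le> 2 * b * (1 - b)")
    case True
    define \<alpha> where "\<alpha> = r / (2 * b * (1 - b))"
    have r': "r = 2 * b * (1 - b) * \<alpha>" using b by (simp add: \<alpha>_def)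
    have \<alpha>: "0 \<le> \<alpha>" "\<alpha> \<le> 1" using True b r by (simp_all add: \<alpha>_def)
    have "r\<^sup>2 = (4 * b * (1 - b)) * (b * (1 - b) * \<alpha>\<^sup>2)"
      by (simp add: r' power2_eq_square)
    then have "r\<^sup>2 / (4 * b * (1 - b)) = b * (1 - b) * \<alpha>\<^sup>2"
      using b by simp
    then have SA: "S \<le> (1 - b) * (1 - b * \<alpha>\<^sup>2)" using True le
      by (simp add: S_def indicatrix_profile_def algebra_simps)
    define \<beta> where "\<beta> = b * \<alpha>"
    have "b * \<alpha> \<le> b * 1" using b \<alpha> by (intro mult_left_mono) auto
    then have "b * \<alpha> < 1" using b by linarith
    then have \<beta>: "0 \<le> \<beta>" "\<beta> < 1" using b \<alpha> by (simp_all add: \<beta>_def)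
    define h where "h = (\<lambda>z. of_real b * ((1 - of_real \<alpha> * z) / (1 - of_real \<beta> * z))\<^sup>2 :: complex)"
    show ?thesis
    proof (rule in_kobayashi_indicatrixI[OF m \<beta>, of h])
      show "h holomorphic_on ball 0 1" unfolding h_def
        using nz[OF \<beta>] by (intro holomorphic_intros) auto
      show "h 0 = of_real b" by (simp add: h_def)
      show "deriv h 0 = X $ k" unfolding h_def
        by (rule DERIV_imp_deriv)
           (auto intro!: derivative_eq_intros simp: Xk r' \<beta>_def algebra_simps)
      fix z :: complex assume z: "norm z < 1"
      have "norm (h z) * (norm (1 - of_real \<beta> * z))\<^sup>2 = b * (norm (1 - of_real \<alpha> * z))\<^sup>2"
        using b nz[OF \<beta> z] by (simp add: h_def norm_mult norm_power norm_divide power_divide)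
      \<comment> \<open>The right-hand side equals \<open>(norm (1 - \<beta> z))\<^sup>2 - b * (norm
        (1 - \<alpha> z))\<^sup>2\<close>. For \<open>S > 0\<close> strictness comes from
        \<open>norm z < 1\<close>; for \<open>S = 0\<close> the right-hand side itself has to be
        shown positive.\<close>
      moreover have "S * norm z powr (2 * m) < (1 - b) * (1 - b * \<alpha>\<^sup>2 * (norm z)\<^sup>2)"
      proof (cases "S = 0")
        case True
        have "\<alpha>\<^sup>2 * (norm z)\<^sup>2 \<le> 1 * 1"
          using \<alpha> z by (intro mult_mono power_le_one) auto
        then have "b * (\<alpha>\<^sup>2 * (norm z)\<^sup>2) \<le> b * 1" using b by (intro mult_left_mono) auto
        then have "0 < 1 - b * (\<alpha>\<^sup>2 * (norm z)\<^sup>2)" using b by linarith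
        then show ?thesis using True b by (simp add: mult.assoc)
      next
        case False
        have "norm z powr (2 * m) < 1 powr (2 * m)" using z m by (intro powr_less_mono2) auto
        then have "S * norm z powr (2 * m) < S" using False S by simp
        also note SA
        also have "(1 - b) * (1 - b * \<alpha>\<^sup>2) \<le> (1 - b) * (1 - b * \<alpha>\<^sup>2 * (norm z)\<^sup>2)"
        proof -
          have "b * \<alpha>\<^sup>2 * (norm z)\<^sup>2 \<le> b * \<alpha>\<^sup>2"
            using b z by (intro mult_left_le power_le_one) auto
          then show ?thesis using b by (intro mult_left_mono) auto
        qed
        finally show ?thesis .
      qed
      ultimately show "norm (h z) * (norm (1 - of_real \<beta> * z))\<^sup>2
        + power_sum k (2 * m) (($) X) * norm z powr (2 * m) < (norm (1 - of_real \<beta> * z))\<^sup>2"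
        unfolding norm_one_minus_power2 by (simp add: S_def \<beta>_def power2_eq_square algebra_simps)
    qed
  next
    case False
    \<comment> \<open>Determined by \<open>deriv h 0 = - r\<close>, as the derivative of
      \<open>h\<close> at 0 is \<open>b * (2 * b - t)\<close>. The present case amounts to
      \<open>t > 2\<close>.\<close>
    define t where "t = (r + 2 * b\<^sup>2) / b"
    have t: "b * t = r + 2 * b\<^sup>2" using b by (simp add: t_def)
    have "b * 2 < b * t" using False unfolding t by (simp add: power2_eq_square algebra_simps)
    then have t2: "2 < t" using b by simp
    have SB: "S \<le> 1 - b\<^sup>2 - r" using False le by (simp add: S_def indicatrix_profile_def)
    have "0 < 2 * b * (1 - b)" using b by simp
    then have r0: "r > 0" using False by linarith
    define h where "h = (\<lambda>z. of_real b * (1 - of_real t * z + z\<^sup>2) / (1 - of_real b * z)\<^sup>2 :: complex)"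
    show ?thesis
    proof (rule in_kobayashi_indicatrixI[OF m _ b(2), of h])
      show "h holomorphic_on ball 0 1" unfolding h_def
        using nz[of b] b by (intro holomorphic_intros) auto
      show "h 0 = of_real b" by (simp add: h_def)
      have "of_real b * of_real t = (of_real r + 2 * (of_real b)\<^sup>2 :: complex)"
        using t by (metis of_real_add of_real_mult of_real_numeral of_real_power)
      then show "deriv h 0 = X $ k" unfolding h_def
        by (intro DERIV_imp_deriv)
           (auto intro!: derivative_eq_intros simp: Xk power2_eq_square algebra_simps)
      fix z :: complex assume z: "norm z < 1"
      \<comment> \<open>The triangle inequality applied to this splitting loses nothing on the unit
        circle, where \<open>(1 - z)\<^sup>2 = - z * (norm (1 - z))\<^sup>2\<close> and both terms
        point in the same direction.\<close>
      have "1 - of_real t * z + z\<^sup>2 = (1 - z)\<^sup>2 - of_real (t - 2) * z"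
        by (simp add: power2_eq_square algebra_simps)
      then have "norm (1 - of_real t * z + z\<^sup>2) \<le> (norm (1 - z))\<^sup>2 + (t - 2) * norm z"
        using norm_triangle_ineq4[of "(1 - z)\<^sup>2" "of_real (t - 2) * z"] t2
        by (simp add: norm_power norm_mult del: of_real_diff)
      also have "(norm (1 - z))\<^sup>2 = 1 - 2 * Re z + (norm z)\<^sup>2"
        using norm_one_minus_power2[of 1 z] by simp
      also have "(t - 2) * norm z \<le> (t - 2) * ((1 + (norm z)\<^sup>2) / 2)"
      proof (rule mult_left_mono)
        show "norm z \<le> (1 + (norm z)\<^sup>2) / 2"
          using zero_le_power2[of "norm z - 1"] by (simp add: power2_diff)
      qed (use t2 in auto)
      finally have "norm (1 - of_real t * z + z\<^sup>2) \<le> t * (1 + (norm z)\<^sup>2) / 2 - 2 * Re z"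
        by (simp add: field_simps)
      then have "b * norm (1 - of_real t * z + z\<^sup>2) \<le> b * (t * (1 + (norm z)\<^sup>2) / 2 - 2 * Re z)"
        using b by (intro mult_left_mono) auto
      also have "\<dots> = (b * t) * (1 + (norm z)\<^sup>2) / 2 - 2 * b * Re z"
        by (simp add: algebra_simps)
      finally have hb: "b * norm (1 - of_real t * z + z\<^sup>2) \<le> (r + 2 * b\<^sup>2) * (1 + (norm z)\<^sup>2) / 2 - 2 * b * Re z"
        by (simp add: t)
      have "norm (h z) * (norm (1 - of_real b * z))\<^sup>2 = b * norm (1 - of_real t * z + z\<^sup>2)"
        using b nz[of b z] z by (simp add: h_def norm_mult norm_power norm_divide)
      \<comment> \<open>The right-hand side is what remains of
        \<open>(norm (1 - b * z))\<^sup>2\<close> after subtracting the bound \<open>hb\<close>.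
        Strictness comes from \<open>r > 0\<close> and therefore includes
        \<open>S = 0\<close>.\<close>
      moreover have "S * norm z powr (2 * m) < 1 - b\<^sup>2 - r / 2 - r * (norm z)\<^sup>2 / 2"
      proof -
        have "(norm z)\<^sup>2 < 1" using z by (simp add: power_less_one_iff abs_square_less_1)
        then have "r * (norm z)\<^sup>2 < r" using r0 by simp
        then show ?thesis using SB Sz[OF z] by simp
      qed
      ultimately show "norm (h z) * (norm (1 - of_real b * z))\<^sup>2
        + power_sum k (2 * m) (($) X) * norm z powr (2 * m) < (norm (1 - of_real b * z))\<^sup>2"
        using hb unfolding norm_one_minus_power2 by (simp add: S_def power2_eq_square algebra_simps add_divide_distrib)
    qed (use b in auto)
  qed
qed

text \<open>The explicit discs cover vectors whose \<open>k\<close>-th entry is a nonpositive real;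
  invariance of the indicatrix under rotations yields the others.\<close>

lemma kobayashi_indicatrix_ellipsoid:
  fixes k :: "'n::finite"
  assumes m: "m \<ge> 1/2" and b: "0 < b" "b < 1"
  shows "kobayashi_indicatrix (ellipsoid k m) (axis k (of_real b)) =
    {X. power_sum k (2 * m) (($) X) \<le> indicatrix_profile b (norm (X $ k))}"
proof (intro equalityI subsetI CollectI)
  fix X assume "X \<in> kobayashi_indicatrix (ellipsoid k m) (axis k (of_real b))"
  then show "power_sum k (2 * m) (($) X) \<le> indicatrix_profile b (norm (X $ k))"
    using power_sum_deriv_le_profile[OF m b] by (auto simp: kobayashi_indicatrix_def power_sum_def)
next
  fix X :: "complex ^ 'n" assume X: "X \<in> {X. power_sum k (2 * m) (($) X) \<le> indicatrix_profile b (norm (X $ k))}"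
  obtain u where u: "norm u = 1" "u * X $ k = - of_real (norm (X $ k))"
    using exists_rotation_to_neg_norm[of "X $ k"] by blast
  have "u *s X \<in> kobayashi_indicatrix (ellipsoid k m) (axis k (of_real b))"
    by (rule profile_in_kobayashi_indicatrix[OF m b, of "norm (X $ k)"])
       (use u X in \<open>auto simp: power_sum_def norm_mult\<close>)
  from kobayashi_indicatrix_rotate[OF _ this, of "inverse u"] u
  show "X \<in> kobayashi_indicatrix (ellipsoid k m) (axis k (of_real b))"
    by (simp add: norm_inverse vector_smult_assoc) (metis left_inverse norm_zero vector_smult_lid zero_neq_one)
qed

section \<open>Volume of the indicatrix\<close>

lemma has_integral_profile_powr:
  assumes b: "0 < b" "b < 1" and a: "2 < a"
  shows "((\<lambda>r. indicatrix_profile b r powr (a - 2) * (2 * pi * r)) has_integral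
    2 * pi * ((1 - b) powr a * (2 * a * b + (1 - b) powr a) / (a * (a - 1)))) {0..1 - b\<^sup>2}"
proof -
  define c where "c = 2 * b * (1 - b)"
  define D where "D = 1 - b\<^sup>2"
  define f where "f = (\<lambda>r. indicatrix_profile b r powr (a - 2) * (2 * pi * r))"
  have c: "0 < c" using b by (simp add: c_def)
  have Dc: "D - c = (1 - b)\<^sup>2" by (simp add: D_def c_def power2_eq_square algebra_simps)
  then have cD: "c < D" using b by (smt (verit) zero_less_power2)
  define P where "P = (\<lambda>r. 1 - b - r\<^sup>2 / (4 * b * (1 - b)))"
  have Pc: "P c = (1 - b)\<^sup>2"
  proof -
    have "c\<^sup>2 = (4 * b * (1 - b)) * (b * (1 - b))" by (simp add: c_def power2_eq_square)
    then have "c\<^sup>2 / (4 * b * (1 - b)) = b * (1 - b)" using b by simp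
    then show ?thesis by (simp add: P_def power2_eq_square algebra_simps)
  qed
  have Ppos: "0 < P r" if "r \<in> {0..c}" for r
  proof -
    have "r\<^sup>2 \<le> c\<^sup>2" using that by (intro power_mono) auto
    then have "P c \<le> P r" unfolding P_def using b by (intro diff_left_mono divide_right_mono) auto
    moreover have "0 < (1 - b)\<^sup>2" using b by simp
    ultimately show ?thesis unfolding Pc by linarith
  qed
  \<comment> \<open>On the quadratic branch the derivative of \<open>P\<close> is
    \<open>- r / c\<close>, so the factor \<open>r\<close> makes the integrand a multiple of the
    derivative of \<open>P powr (a - 1)\<close>.\<close>
  define F1 where "F1 = (\<lambda>r. - 2 * pi * c / (a - 1) * P r powr (a - 1))"
  have 1: "(f has_integral F1 c - F1 0) {0..c}"
  proof -
    have "((\<lambda>r. P r powr (a - 2) * (2 * pi * r)) has_integral F1 c - F1 0) {0..c}"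
    proof (rule fundamental_theorem_of_calculus)
      fix r assume r: "r \<in> {0..c}"
      have "(P has_real_derivative - (r / c)) (at r)"
      proof -
        have "4 * b * (1 - b) = 2 * c" by (simp add: c_def)
        then show ?thesis unfolding P_def using c by (auto intro!: derivative_eq_intros)
      qed
      then have "((\<lambda>r. P r powr (a - 1)) has_real_derivative (a - 1) * P r powr (a - 1 - of_nat 1) * (- (r / c))) (at r)"
        using Ppos[OF r] by (rule DERIV_fun_powr)
      from DERIV_cmult[OF this, of "- 2 * pi * c / (a - 1)"]
      have "(F1 has_real_derivative P r powr (a - 2) * (2 * pi * r)) (at r)"
        unfolding F1_def using a c by (simp add: mult_ac)
      then show "(F1 has_vector_derivative P r powr (a - 2) * (2 * pi * r)) (at r within {0..c})"
        by (simp add: has_field_derivative_at_within flip: has_real_derivative_iff_has_vector_derivative)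
    qed (use c in auto)
    then show ?thesis
      by (rule has_integral_eq[rotated]) (auto simp: f_def indicatrix_profile_def P_def c_def)
  qed
  \<comment> \<open>On the linear branch \<open>r = D - (D - r)\<close> splits the integrand into
    two powers of \<open>D - r\<close>. The base vanishes at \<open>r = D\<close>, so
    differentiability is used only in the interior.\<close>
  define F2 where "F2 = (\<lambda>r. 2 * pi * ((D - r) powr a / a - D / (a - 1) * (D - r) powr (a - 1)))"
  have 2: "(f has_integral F2 D - F2 c) {c..D}"
  proof -
    have "((\<lambda>r. (D - r) powr (a - 2) * (2 * pi * r)) has_integral F2 D - F2 c) {c..D}"
    proof (rule fundamental_theorem_of_calculus_interior)
      show "continuous_on {c..D} F2"
        unfolding F2_def using a by (intro continuous_intros continuous_on_powr') auto
      fix r assume r: "r \<in> {c<..<D}"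
      have d: "((\<lambda>r. D - r) has_real_derivative - 1) (at r)" by (auto intro!: derivative_eq_intros)
      have pw: "((\<lambda>r. (D - r) powr e) has_real_derivative e * (D - r) powr (e - 1) * (- 1)) (at r)" for e
        using r DERIV_fun_powr[OF d, of e] by simp
      have "(F2 has_real_derivative 2 * pi * (a * (D - r) powr (a - 1) * (- 1) / a - D / (a - 1) * ((a - 1) * (D - r) powr (a - 1 - 1) * (- 1)))) (at r)"
        unfolding F2_def by (intro DERIV_cmult DERIV_diff DERIV_cdivide pw)
      moreover have "2 * pi * (a * (D - r) powr (a - 1) * (- 1) / a - D / (a - 1) * ((a - 1) * (D - r) powr (a - 1 - 1) * (- 1))) = (D - r) powr (a - 2) * (2 * pi * r)"
      proof -
        have "(D - r) powr (a - 1) = (D - r) powr (a - 2) * (D - r)"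
          using r powr_add[of "D - r" "a - 2" 1] by simp
        moreover have "2 * pi * (a * X * (- 1) / a - D / (a - 1) * ((a - 1) * Y * (- 1))) = 2 * pi * (D * Y - X)" for X Y
          using a by simp
        moreover have "a - 1 - 1 = a - 2" by simp
        moreover have "2 * pi * (D * Y - Y * (D - r)) = Y * (2 * pi * r)" for Y by (simp add: algebra_simps)
        ultimately show ?thesis by (simp only:)
      qed
      ultimately have "(F2 has_real_derivative (D - r) powr (a - 2) * (2 * pi * r)) (at r)"
        by (simp only:)
      then show "(F2 has_vector_derivative (D - r) powr (a - 2) * (2 * pi * r)) (at r)"
        by (simp flip: has_real_derivative_iff_has_vector_derivative)
    qed (use cD in auto)
    then show ?thesis
    \<comment> \<open>At \<open>c\<close> itself the profile is defined by the other branch; one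
      point does not affect the integral.\<close>
    proof (rule has_integral_spike_finite[of "{c}", rotated 2])
      show "f r = (D - r) powr (a - 2) * (2 * pi * r)" if "r \<in> {c..D} - {c}" for r
        using that by (auto simp: f_def indicatrix_profile_def c_def D_def)
    qed auto
  qed
  have "(f has_integral (F1 c - F1 0) + (F2 D - F2 c)) {0..D}"
    by (rule has_integral_combine[OF _ _ 1 2]) (use c cD in auto)
  moreover have "(F1 c - F1 0) + (F2 D - F2 c) = 2 * pi * ((1 - b) powr a * (2 * a * b + (1 - b) powr a) / (a * (a - 1)))"
  proof -
    define x where "x = (1 - b) powr a"
    have x: "x > 0" using b by (simp add: x_def)
    have sq: "((1 - b)\<^sup>2) powr e = ((1 - b) powr e)\<^sup>2" for e
      using b by (simp add: powr_power powr_powr mult.commute flip: powr_numeral)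
    have x1: "(1 - b) powr (a - 1) = x / (1 - b)" using b by (simp add: x_def powr_diff)
    have "F1 c - F1 0 = 2 * pi * c / (a - 1) * (x / (1 - b) - (x / (1 - b))\<^sup>2)"
    proof -
      define K where "K = 2 * pi * c / (a - 1)"
      have K: "- 2 * pi * c / (a - 1) = - K" by (simp add: K_def)
      have P0: "P 0 = 1 - b" by (simp add: P_def)
      show ?thesis unfolding F1_def K K_def[symmetric] Pc sq P0
        by (simp add: x1 algebra_simps)
    qed
    also have "\<dots> = 2 * pi * (c * (x / (1 - b)) - c * (x / (1 - b))\<^sup>2) / (a - 1)"
      by (simp only: right_diff_distrib diff_divide_distrib) (simp add: mult_ac)
    also have "c * (x / (1 - b)) = 2 * b * x" using b by (simp add: c_def)
    also have "c * (x / (1 - b))\<^sup>2 = 2 * b * x\<^sup>2 / (1 - b)" using b by (simp add: c_def power2_eq_square)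
    finally have e1: "F1 c - F1 0 = 2 * pi * (2 * b * x - 2 * b * x\<^sup>2 / (1 - b)) / (a - 1)" .
    have "F2 D - F2 c = 2 * pi * (D / (a - 1) * (x / (1 - b))\<^sup>2 - x\<^sup>2 / a)"
      using a by (simp add: F2_def Dc sq x1) (simp add: x_def algebra_simps)
    also have "D / (a - 1) * (x / (1 - b))\<^sup>2 = (1 + b) * x\<^sup>2 / (1 - b) / (a - 1)"
    proof -
      have "D = (1 + b) * (1 - b)" by (simp add: D_def power2_eq_square algebra_simps)
      then show ?thesis using b by (simp add: power2_eq_square)
    qed
    finally have e2: "F2 D - F2 c = 2 * pi * ((1 + b) * x\<^sup>2 / (1 - b) / (a - 1) - x\<^sup>2 / a)" .
    have "(1 + b) * x\<^sup>2 / (1 - b) - 2 * b * x\<^sup>2 / (1 - b) = x\<^sup>2"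
      using b by (simp add: diff_divide_distrib[symmetric] left_diff_distrib[symmetric])
    then have "(1 + b) * x\<^sup>2 / (1 - b) = x\<^sup>2 + 2 * b * x\<^sup>2 / (1 - b)" by simp
    then have "(F1 c - F1 0) + (F2 D - F2 c) = 2 * pi * ((2 * b * x + x\<^sup>2) / (a - 1) - x\<^sup>2 / a)"
      unfolding e1 e2 by (simp add: algebra_simps add_divide_distrib diff_divide_distrib)
    also have "\<dots> = 2 * pi * (x * (2 * a * b + x) / (a * (a - 1)))"
      using a by (simp add: field_simps power2_eq_square)
    finally show ?thesis by (simp add: x_def)
  qed
  ultimately show ?thesis by (simp add: f_def D_def)
qed

lemma emeasure_kobayashi_indicatrix:
  fixes k :: "'n::finite"
  assumes n: "CARD('n) \<ge> 2" and m: "m \<ge> 1/2" and b: "0 < b" "b < 1"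
    and a: "a = (real CARD('n) - 1) / m + 2"
  shows "emeasure lebesgue (kobayashi_indicatrix (ellipsoid k m) (axis k (of_real b))) =
    fibre_volume k (2 * m) 1 * ennreal (2 * pi * ((1 - b) powr a * (2 * a * b + (1 - b) powr a) / (a * (a - 1))))"
proof -
  have a2: "a > 2" using n m by (simp add: a)
  \<comment> \<open>Identifies the scaling exponent of \<open>fibre_volume\<close> for
    \<open>p = 2 * m\<close>.\<close>
  have q: "2 * (real CARD('n) - 1) / (2 * m) = a - 2" using m unfolding a by (subst mult_divide_mult_cancel_left) auto
  have [measurable]: "indicatrix_profile b \<in> borel_measurable borel"
    unfolding indicatrix_profile_def by measurable
  have [measurable]: "(\<lambda>z::complex^'n. z $ i) \<in> borel_measurable borel" for i
    by (intro borel_measurable_continuous_onI continuous_intros)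
  let ?I = "{X::complex^'n. power_sum k (2 * m) (($) X) \<le> indicatrix_profile b (norm (X $ k))}"
  have I [measurable]: "?I \<in> sets borel" by measurable
  have [measurable]: "fibre_volume k (2 * m) \<in> borel_measurable borel"
    using m by (intro measurable_fibre_volume) simp
  define G :: "complex \<Rightarrow> real \<Rightarrow> ennreal" where "G = (\<lambda>u s. indicator {(u, s). s \<le> indicatrix_profile b (norm u)} (u, s))"
  have G: "case_prod G \<in> borel_measurable (borel \<Otimes>\<^sub>M borel)"
    unfolding G_def by measurable
  have "emeasure lebesgue ?I = (\<integral>\<^sup>+X. G (X $ k) (power_sum k (2 * m) (($) X)) \<partial>lborel)"
  proof -
    have "emeasure lebesgue ?I = (\<integral>\<^sup>+X. indicator ?I X \<partial>lborel)" using I by simp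
    also have "\<dots> = (\<integral>\<^sup>+X. G (X $ k) (power_sum k (2 * m) (($) X)) \<partial>lborel)"
      by (intro nn_integral_cong) (auto simp: G_def indicator_def)
    finally show ?thesis .
  qed
  also have "\<dots> = (\<integral>\<^sup>+u. (\<integral>\<^sup>+f. G u (power_sum k (2 * m) f) \<partial>fibre_measure k) \<partial>lborel)"
    by (rule nn_integral_coordinate_power_sum[OF G])
  also have "\<dots> = (\<integral>\<^sup>+u. fibre_volume k (2 * m) (indicatrix_profile b (norm (u::complex))) \<partial>lborel)"
  proof (intro nn_integral_cong)
    fix u :: complex
    have "(\<integral>\<^sup>+f. G u (power_sum k (2 * m) f) \<partial>fibre_measure k) =
      (\<integral>\<^sup>+f. indicator {f \<in> space (fibre_measure k). power_sum k (2 * m) f \<le> indicatrix_profile b (norm u)} f \<partial>fibre_measure k)"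
      by (intro nn_integral_cong) (auto simp: G_def indicator_def)
    then show "(\<integral>\<^sup>+f. G u (power_sum k (2 * m) f) \<partial>fibre_measure k) = fibre_volume k (2 * m) (indicatrix_profile b (norm u))"
      by (simp add: fibre_volume_def)
  qed
  also have "\<dots> = (\<integral>\<^sup>+r. fibre_volume k (2 * m) (indicatrix_profile b r) * ennreal (2 * pi * r) * indicator {0..} r \<partial>lborel)"
    by (rule nn_integral_complex_radial) measurable
  also have "\<dots> = (\<integral>\<^sup>+r. fibre_volume k (2 * m) 1 * (ennreal (indicatrix_profile b r powr (a - 2) * (2 * pi * r)) * indicator {0..1 - b\<^sup>2} r) \<partial>lborel)"
  proof (rule nn_integral_cong_AE)
    \<comment> \<open>At this radius the profile is zero, where neither
      \<open>fibre_volume_scale\<close> nor \<open>fibre_volume_neg\<close> applies.\<close>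
    have "AE r in lborel. r \<noteq> 1 - b\<^sup>2" by (rule AE_lborel_singleton)
    then show "AE r in lborel. fibre_volume k (2 * m) (indicatrix_profile b r) * ennreal (2 * pi * r) * indicator {0..} r =
        fibre_volume k (2 * m) 1 * (ennreal (indicatrix_profile b r powr (a - 2) * (2 * pi * r)) * indicator {0..1 - b\<^sup>2} r)"
    proof (rule AE_mp, intro AE_I2 impI)
      fix r :: real assume ne: "r \<noteq> 1 - b\<^sup>2"
      have c: "1 - b\<^sup>2 - 2 * b * (1 - b) = (1 - b)\<^sup>2" by (simp add: power2_eq_square algebra_simps)
      have c': "0 < (1 - b)\<^sup>2" using b by simp
      consider "r < 0" | "0 \<le> r" "r < 1 - b\<^sup>2" | "r > 1 - b\<^sup>2" using ne by linarith
      then show "fibre_volume k (2 * m) (indicatrix_profile b r) * ennreal (2 * pi * r) * indicator {0..} r =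
        fibre_volume k (2 * m) 1 * (ennreal (indicatrix_profile b r powr (a - 2) * (2 * pi * r)) * indicator {0..1 - b\<^sup>2} r)"
      proof cases
        case 2
        have "0 < indicatrix_profile b r"
        proof (cases "r \<le> 2 * b * (1 - b)")
          case True
          have "r\<^sup>2 \<le> (2 * b * (1 - b))\<^sup>2" using True 2 by (intro power_mono) auto
          also have "\<dots> = (4 * b * (1 - b)) * (b * (1 - b))" by (simp add: power2_eq_square)
          finally have "r\<^sup>2 / (4 * b * (1 - b)) \<le> b * (1 - b)" using b by (simp add: divide_le_eq mult.commute)
          also have "b * (1 - b) < 1 - b" using b by simp
          finally show ?thesis using True by (simp add: indicatrix_profile_def)
        qed (use 2 in \<open>simp add: indicatrix_profile_def\<close>)
        then have "fibre_volume k (2 * m) (indicatrix_profile b r) = ennreal (indicatrix_profile b r powr (a - 2)) * fibre_volume k (2 * m) 1"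
          using fibre_volume_scale[of "indicatrix_profile b r" "2 * m" k] m unfolding q by simp
        then show ?thesis using 2 by (simp add: ennreal_mult mult_ac)
      next
        case 3
        then have "2 * b * (1 - b) < r" using c c' by linarith
        with 3 have "indicatrix_profile b r < 0"
          by (simp add: indicatrix_profile_def)
        then have "fibre_volume k (2 * m) (indicatrix_profile b r) = 0"
          by (rule fibre_volume_neg)
        then show ?thesis using 3 by simp
      qed simp
    qed
  qed
  also have "\<dots> = fibre_volume k (2 * m) 1 * (\<integral>\<^sup>+r. ennreal (indicatrix_profile b r powr (a - 2) * (2 * pi * r)) * indicator {0..1 - b\<^sup>2} r \<partial>lborel)"
    by (rule nn_integral_cmult) measurable
  also have "(\<integral>\<^sup>+r. ennreal (indicatrix_profile b r powr (a - 2) * (2 * pi * r)) * indicator {0..1 - b\<^sup>2} r \<partial>lborel) =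
     ennreal (2 * pi * ((1 - b) powr a * (2 * a * b + (1 - b) powr a) / (a * (a - 1))))"
    by (rule nn_integral_has_integral_lebesgue'[OF _ has_integral_profile_powr[OF b a2]]) auto
  finally show ?thesis by (simp add: kobayashi_indicatrix_ellipsoid[OF m b])
qed

subsection \<open>The Bergman kernel\<close>

lemma has_integral_circle_orthonormal:
  "((\<lambda>t. exp (2 * of_real pi * \<i> * of_real t) ^ j / exp (2 * of_real pi * \<i> * of_real t) ^ l)
    has_integral (if j = l then 1 else 0 :: complex)) {0..1}"
proof -
  have "(deriv ^^ l) (\<lambda>w::complex. w ^ j) 0 = (if j = l then fact j else 0)"
  proof -
    have eq: "(deriv ^^ l) (\<lambda>w::complex. (w - 0) ^ j) 0 = pochhammer (of_nat (Suc j - l)) l * (0 - 0) ^ (j - l)"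
      by (rule higher_deriv_power)
    consider "l < j" | "l = j" | "l > j" by linarith
    then show ?thesis
      by cases (use eq in \<open>auto simp: pochhammer_fact[symmetric] pochhammer_0_left\<close>)
  qed
  moreover have "(\<lambda>z::complex. z ^ j) holomorphic_on ball 0 2" by (intro holomorphic_intros)
  ultimately show ?thesis
    using has_integral_circle_coefficient[of "\<lambda>z. z ^ j" 2 1 l] by (cases "j = l") auto
qed

lemma cnj_exp_circle: "cnj (exp (2 * of_real pi * \<i> * of_real t)) = inverse (exp (2 * of_real pi * \<i> * of_real t))"
  by (simp add: exp_cnj flip: exp_minus)

text \<open>Parseval's identity: the square is expanded as a double sum, and orthonormality leaves
  the diagonal.\<close>

lemma circle_mean_polynomial_norm_square:
  fixes d :: "nat \<Rightarrow> complex"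
  shows "((\<lambda>t. (norm (\<Sum>j<N. d j * exp (2 * of_real pi * \<i> * of_real t) ^ j))\<^sup>2) has_integral (\<Sum>j<N. (norm (d j))\<^sup>2)) {0..1}"
proof -
  let ?e = "\<lambda>t::real. exp (2 * of_real pi * \<i> * of_real t) :: complex"
  have "((\<lambda>t. \<Sum>j<N. \<Sum>l<N. d j * cnj (d l) * (?e t ^ j / ?e t ^ l)) has_integral
      (\<Sum>j<N. \<Sum>l<N. d j * cnj (d l) * (if j = l then 1 else 0))) {0..1}"
    by (intro has_integral_sum has_integral_mult_right has_integral_circle_orthonormal) auto
  also have "(\<Sum>j<N. \<Sum>l<N. d j * cnj (d l) * (if j = l then 1 else 0)) = of_real (\<Sum>j<N. (norm (d j))\<^sup>2)"
    by (simp add: complex_norm_square[symmetric] if_distrib cong: if_cong)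
  also have "(\<lambda>t. \<Sum>j<N. \<Sum>l<N. d j * cnj (d l) * (?e t ^ j / ?e t ^ l)) =
      (\<lambda>t. of_real ((norm (\<Sum>j<N. d j * ?e t ^ j))\<^sup>2))"
    unfolding complex_norm_square cnj_sum sum_product
    by (intro ext sum.cong refl) (simp add: cnj_exp_circle power_inverse divide_inverse)
  finally have "((\<lambda>t. complex_of_real ((norm (\<Sum>j<N. d j * ?e t ^ j))\<^sup>2)) has_integral of_real (\<Sum>j<N. (norm (d j))\<^sup>2)) {0..1}" .
  from has_integral_Re[OF this] show ?thesis
    by (simp only: Re_complex_of_real)
qed

text \<open>With \<open>P\<close> the Taylor polynomial, the mean of \<open>f * cnj P\<close> is the
  sum of the squared moduli of the coefficients, as is that of \<open>(norm P)\<^sup>2\<close>. The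
  inequality is the integral of \<open>(norm (f - P))\<^sup>2 \<ge> 0\<close>.\<close>

lemma circle_bessel_inequality:
  assumes f: "f holomorphic_on ball 0 R" and R: "1 < R"
  shows "(\<Sum>j<N. (norm ((deriv ^^ j) f 0 / fact j))\<^sup>2) \<le> integral {0..1} (\<lambda>t. (norm (f (exp (2 * of_real pi * \<i> * of_real t))))\<^sup>2)"
proof -
  let ?e = "\<lambda>t::real. exp (2 * of_real pi * \<i> * of_real t) :: complex"
  define d where "d = (\<lambda>j. (deriv ^^ j) f 0 / fact j)"
  define P where "P = (\<lambda>t. \<Sum>j<N. d j * ?e t ^ j)"
  have P: "((\<lambda>t. (norm (P t))\<^sup>2) has_integral (\<Sum>j<N. (norm (d j))\<^sup>2)) {0..1}"
    unfolding P_def by (rule circle_mean_polynomial_norm_square)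
  have fe: "continuous_on {0..1} (\<lambda>t. f (?e t))"
    by (rule continuous_on_compose2[OF holomorphic_on_imp_continuous_on[OF f]])
       (use R in \<open>auto intro!: continuous_intros\<close>)
  have "((\<lambda>t. f (?e t) / ?e t ^ j) has_integral d j) {0..1}" for j
    using has_integral_circle_coefficient[OF f _ R, of j] by (simp add: d_def)
  then have "((\<lambda>t. \<Sum>j<N. cnj (d j) * (f (?e t) / ?e t ^ j)) has_integral (\<Sum>j<N. cnj (d j) * d j)) {0..1}"
    by (intro has_integral_sum has_integral_mult_right) auto
  also have "(\<lambda>t. \<Sum>j<N. cnj (d j) * (f (?e t) / ?e t ^ j)) = (\<lambda>t. f (?e t) * cnj (P t))"
    unfolding P_def cnj_sum sum_distrib_left
    by (intro ext sum.cong refl) (simp add: cnj_exp_circle power_inverse divide_inverse)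
  also have "(\<Sum>j<N. cnj (d j) * d j) = of_real (\<Sum>j<N. (norm (d j))\<^sup>2)"
    unfolding of_real_sum complex_norm_square by (simp add: mult.commute)
  finally have "((\<lambda>t. f (?e t) * cnj (P t)) has_integral of_real (\<Sum>j<N. (norm (d j))\<^sup>2)) {0..1}" .
  from has_integral_Re[OF this]
  have "((\<lambda>t. Re (f (?e t) * cnj (P t))) has_integral (\<Sum>j<N. (norm (d j))\<^sup>2)) {0..1}"
    by (simp only: Re_complex_of_real)
  from has_integral_diff[OF has_integral_mult_right[OF this, of 2] P]
  have i: "((\<lambda>t. 2 * Re (f (?e t) * cnj (P t)) - (norm (P t))\<^sup>2) has_integral (\<Sum>j<N. (norm (d j))\<^sup>2)) {0..1}"
    by simp
  have "(\<Sum>j<N. (norm (d j))\<^sup>2) \<le> integral {0..1} (\<lambda>t. (norm (f (?e t)))\<^sup>2)"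
    unfolding integral_unique[OF i, symmetric]
  proof (rule integral_le)
    show "(\<lambda>t. (norm (f (?e t)))\<^sup>2) integrable_on {0..1}"
      by (intro integrable_continuous_real continuous_intros fe)
    show "2 * Re (f (?e t) * cnj (P t)) - (norm (P t))\<^sup>2 \<le> (norm (f (?e t)))\<^sup>2" for t
      using zero_le_power2[of "norm (f (?e t) - P t)"]
      unfolding cmod_power2 by (simp add: power2_eq_square algebra_simps)
  qed (use i in auto)
  then show ?thesis by (simp add: d_def)
qed

section \<open>Averages over rotations of the coordinates\<close>

definition circle_action :: "('n \<Rightarrow> nat) \<Rightarrow> real \<Rightarrow> complex ^ 'n \<Rightarrow> complex ^ 'n" where
  "circle_action e t z = (\<chi> i. exp (2 * of_real pi * \<i> * of_real t) ^ e i * z $ i)"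

text \<open>Each rotation preserves the integral, so its mean over \<open>t\<close> does too, and
  Tonelli's theorem moves the mean inside. The exponents \<open>e\<close> used below are 0 and 1:
  they rotate the coordinate \<open>k\<close> alone or all the others.\<close>

lemma nn_integral_circle_average:
  fixes h :: "complex ^ 'n::finite \<Rightarrow> ennreal"
  assumes [measurable]: "h \<in> borel_measurable borel"
  shows "(\<integral>\<^sup>+z. h z \<partial>lborel) = (\<integral>\<^sup>+z. (\<integral>\<^sup>+t. h (circle_action e t z) * indicator {0..1} t \<partial>lborel) \<partial>lborel)"
proof -
  have "(\<lambda>x. circle_action e (snd x) (fst x)) \<in> borel_measurable (borel :: ((complex^'n) \<times> real) measure)"
    unfolding circle_action_def
    by (intro borel_measurable_continuous_onI continuous_intros continuous_on_vec_lambda)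
  then have T [measurable]: "(\<lambda>x. circle_action e (snd x) (fst x)) \<in> borel_measurable (lborel \<Otimes>\<^sub>M lborel)"
    by (simp add: lborel_prod)
  have m: "(\<lambda>(z, t). h (circle_action e t z) * indicator {0..1} t) \<in> borel_measurable (lborel \<Otimes>\<^sub>M lborel)"
    unfolding case_prod_beta by measurable
  have inv: "(\<integral>\<^sup>+z. h (circle_action e t z) \<partial>lborel) = (\<integral>\<^sup>+z. h z \<partial>lborel)" for t
  proof -
    let ?u = "\<lambda>i. exp (2 * of_real pi * \<i> * of_real t) ^ e i :: complex"
    have [measurable]: "(\<lambda>z. \<chi> i. ?u i * z $ i) \<in> borel_measurable borel"
      by (intro borel_measurable_continuous_onI continuous_intros)
    have "(\<integral>\<^sup>+z. h z \<partial>lborel) = (\<integral>\<^sup>+z. h z \<partial>distr lborel borel (\<lambda>z. \<chi> i. ?u i * z $ i))"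
      by (subst distr_vec_rotation) (auto simp: norm_power)
    also have "\<dots> = (\<integral>\<^sup>+z. h (circle_action e t z) \<partial>lborel)"
      by (simp add: nn_integral_distr circle_action_def)
    finally show ?thesis ..
  qed
  have "(\<integral>\<^sup>+z. (\<integral>\<^sup>+t. h (circle_action e t z) * indicator {0..1} t \<partial>lborel) \<partial>lborel) =
    (\<integral>\<^sup>+t. (\<integral>\<^sup>+z. h (circle_action e t z) * indicator {0..1} t \<partial>lborel) \<partial>lborel)"
    using lborel_pair.Fubini'[OF m] by simp
  also have "\<dots> = (\<integral>\<^sup>+t. (\<integral>\<^sup>+z. h z \<partial>lborel) * indicator {0..1::real} t \<partial>lborel)"
  proof (intro nn_integral_cong)
    fix t :: real
    have "(\<lambda>z. circle_action e t z) \<in> borel_measurable borel"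
      unfolding circle_action_def by (intro borel_measurable_continuous_onI continuous_intros)
    then have "(\<lambda>z. h (circle_action e t z)) \<in> borel_measurable borel" by measurable
    then show "(\<integral>\<^sup>+z. h (circle_action e t z) * indicator {0..1} t \<partial>lborel) = (\<integral>\<^sup>+z. h z \<partial>lborel) * indicator {0..1} t"
      by (simp add: nn_integral_multc inv)
  qed
  also have "\<dots> = (\<integral>\<^sup>+z. h z \<partial>lborel)" by (simp add: nn_integral_cmult_indicator)
  finally show ?thesis ..
qed

lemma open_ellipsoid: "m > 0 \<Longrightarrow> open (ellipsoid k m)" for k :: "'n::finite"
  unfolding ellipsoid_def
  by (intro open_Collect_less continuous_intros continuous_on_powr') auto

lemma circle_action_in_ellipsoid_iff [simp]:
  "circle_action e t z \<in> ellipsoid k m \<longleftrightarrow> z \<in> ellipsoid k m"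
  by (simp add: ellipsoid_def circle_action_def norm_mult norm_power)

lemma holomorphic_functions_continuous_on:
  assumes "f \<in> holomorphic_functions \<Omega>" shows "continuous_on \<Omega> f"
proof (rule continuous_at_imp_continuous_on, rule ballI)
  fix z assume "z \<in> \<Omega>"
  then obtain D where "(f has_derivative D) (at z)" using assms by (auto simp: holomorphic_functions_def)
  then show "isCont f z" by (rule has_derivative_continuous)
qed

text \<open>Restricts to one complex variable: complex linearity of \<open>D\<close> turns the
  derivative along the line into multiplication by \<open>D v\<close>.\<close>

lemma holomorphic_functions_line:
  assumes f: "f \<in> holomorphic_functions \<Omega>" and S: "open S"
    and sub: "\<And>\<zeta>. \<zeta> \<in> S \<Longrightarrow> p + \<zeta> *s v \<in> \<Omega>"
  shows "(\<lambda>\<zeta>. f (p + \<zeta> *s v)) holomorphic_on S"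
  unfolding holomorphic_on_def
proof
  fix \<zeta> assume "\<zeta> \<in> S"
  then obtain D where D: "(f has_derivative D) (at (p + \<zeta> *s v))" and lin: "\<And>c v. D (c *s v) = c * D v"
    using f sub by (fastforce simp: holomorphic_functions_def)
  have "bounded_linear (\<lambda>h::complex. h *s v)"
    by (intro linear_conv_bounded_linear[THEN iffD1] linearI) (auto simp: vec_eq_iff algebra_simps)
  then have "((\<lambda>\<zeta>. p + \<zeta> *s v) has_derivative (\<lambda>h. h *s v)) (at \<zeta>)"
    using has_derivative_add[OF has_derivative_const bounded_linear.has_derivative[OF _ has_derivative_ident]] by fastforce
  from has_derivative_compose[OF this D] have "((\<lambda>\<zeta>. f (p + \<zeta> *s v)) has_derivative (\<lambda>h. D (h *s v))) (at \<zeta>)" .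
  also have "(\<lambda>h. D (h *s v)) = (*) (D v)" by (auto simp: lin mult.commute)
  finally have "((\<lambda>\<zeta>. f (p + \<zeta> *s v)) has_field_derivative D v) (at \<zeta>)" by (simp add: has_field_derivative_def)
  then show "(\<lambda>\<zeta>. f (p + \<zeta> *s v)) field_differentiable (at \<zeta> within S)"
    using field_differentiable_at_within field_differentiable_def by blast
qed

section \<open>The kernel on the axis as a series of reciprocal squared monomial norms\<close>

definition monomial_norm :: "'n::finite \<Rightarrow> real \<Rightarrow> nat \<Rightarrow> ennreal" where
  "monomial_norm k m j = (\<integral>\<^sup>+z\<in>ellipsoid k m. ennreal (norm (z $ k) ^ (2 * j)) \<partial>lborel)"

text \<open>Nothing is known about \<open>f\<close> outside the ellipsoid, so measurability is
  asserted for the product with the indicator.\<close>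

lemma measurable_indicator_ellipsoid:
  fixes k :: "'n::finite" and f :: "complex ^ 'n \<Rightarrow> complex"
  assumes m: "m > 0" and f: "continuous_on (ellipsoid k m) f"
  shows "(\<lambda>z. ennreal ((norm (f z))\<^sup>2) * indicator (ellipsoid k m) z) \<in> borel_measurable borel"
proof -
  have "(\<lambda>z. indicator (ellipsoid k m) z *\<^sub>R (norm (f z))\<^sup>2) \<in> borel_measurable borel"
    by (intro borel_measurable_continuous_on_indicator continuous_intros f borel_open open_ellipsoid m)
  then have "(\<lambda>z. ennreal (indicator (ellipsoid k m) z *\<^sub>R (norm (f z))\<^sup>2)) \<in> borel_measurable borel" by measurable
  also have "(\<lambda>z. ennreal (indicator (ellipsoid k m) z *\<^sub>R (norm (f z))\<^sup>2)) = (\<lambda>z. ennreal ((norm (f z))\<^sup>2) * indicator (ellipsoid k m) z)"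
    by (auto simp: indicator_def)
  finally show ?thesis .
qed

lemma sum_monomial_norm:
  fixes k :: "'n::finite"
  assumes m: "m > 0" and c: "\<And>j. 0 \<le> c j"
  shows "(\<integral>\<^sup>+z\<in>ellipsoid k m. ennreal (\<Sum>j<N. c j * norm (z $ k) ^ (2 * j)) \<partial>lborel) = (\<Sum>j<N. ennreal (c j) * monomial_norm k m j)"
proof -
  have [measurable]: "ellipsoid k m \<in> sets borel" by (intro borel_open open_ellipsoid m)
  have [measurable]: "(\<lambda>z::complex^'n. z $ i) \<in> borel_measurable borel" for i
    by (intro borel_measurable_continuous_onI continuous_intros)
  have "(\<integral>\<^sup>+z\<in>ellipsoid k m. ennreal (\<Sum>j<N. c j * norm (z $ k) ^ (2 * j)) \<partial>lborel) =
    (\<integral>\<^sup>+z. (\<Sum>j<N. ennreal (c j) * (ennreal (norm (z $ k) ^ (2 * j)) * indicator (ellipsoid k m) z)) \<partial>lborel)"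
  proof (rule nn_integral_cong)
    fix z :: "complex ^ 'n"
    have "ennreal (\<Sum>j<N. c j * norm (z $ k) ^ (2 * j)) = (\<Sum>j<N. ennreal (c j * norm (z $ k) ^ (2 * j)))"
      using c by (intro sum_ennreal[symmetric]) auto
    then show "ennreal (\<Sum>j<N. c j * norm (z $ k) ^ (2 * j)) * indicator (ellipsoid k m) z =
      (\<Sum>j<N. ennreal (c j) * (ennreal (norm (z $ k) ^ (2 * j)) * indicator (ellipsoid k m) z))"
      using c by (simp add: sum_distrib_right ennreal_mult mult.assoc)
  qed
  also have "\<dots> = (\<Sum>j<N. ennreal (c j) * monomial_norm k m j)"
    unfolding monomial_norm_def by (subst nn_integral_sum) (auto simp: nn_integral_cmult)
  finally show ?thesis .
qed

text \<open>Averaging over rotations of all coordinates but the \<open>k\<close>-th replaces \<open>f\<close> by its restriction to the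
  \<open>k\<close>-th axis; averaging over rotations of the \<open>k\<close>-th coordinate then gives the coefficients.\<close>

lemma bergman_coefficient_bound:
  fixes k :: "'n::finite"
  assumes m: "m > 0" and f: "f \<in> holomorphic_functions (ellipsoid k m)"
  shows "(\<Sum>j<N. ennreal ((norm ((deriv ^^ j) (\<lambda>\<zeta>. f (axis k \<zeta>)) 0 / fact j))\<^sup>2) * monomial_norm k m j)
    \<le> (\<integral>\<^sup>+z\<in>ellipsoid k m. ennreal ((norm (f z))\<^sup>2) \<partial>lborel)"
proof -
  let ?\<Omega> = "ellipsoid k m"
  let ?e = "\<lambda>t::real. exp (2 * of_real pi * \<i> * of_real t) :: complex"
  have fc: "continuous_on ?\<Omega> f" by (rule holomorphic_functions_continuous_on[OF f])
  define g where "g = (\<lambda>\<zeta>. f (axis k \<zeta>))"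
  have ax: "axis k \<zeta> \<in> ?\<Omega>" if "norm \<zeta> < 1" for \<zeta>
    using that m by (simp add: ellipsoid_def axis_def)
  have g: "g holomorphic_on ball 0 1"
  proof -
    have axs: "0 + \<zeta> *s axis k 1 = axis k \<zeta>" for \<zeta> :: complex by (auto simp: vec_eq_iff axis_def)
    have "(\<lambda>\<zeta>. f (0 + \<zeta> *s axis k 1)) holomorphic_on ball 0 1"
      by (rule holomorphic_functions_line[OF f]) (use ax in \<open>auto simp only: axs mem_ball_0 open_ball\<close>)
    then show ?thesis unfolding axs g_def .
  qed
  have proj: "norm (z $ k) < 1" if "z \<in> ?\<Omega>" for z
    using that power_sum_nonneg[of k "2 * m" "($) z"] by (auto simp: in_ellipsoid_iff)
  have gc: "continuous_on ?\<Omega> (\<lambda>z. g (z $ k))"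
    by (rule continuous_on_compose2[OF holomorphic_on_imp_continuous_on[OF g]])
       (auto intro!: continuous_intros proj)
  define d where "d = (\<lambda>j. (deriv ^^ j) g 0 / fact j)"
  note nni = nn_integral_has_integral_lebesgue'[of "{0..1::real}", OF _ integrable_integral]
  have step1: "ennreal ((norm (g (z $ k)))\<^sup>2) * indicator ?\<Omega> z \<le>
    (\<integral>\<^sup>+t. ennreal ((norm (f (circle_action (\<lambda>i. if i = k then 0 else 1) t z)))\<^sup>2) * indicator ?\<Omega> (circle_action (\<lambda>i. if i = k then 0 else 1) t z) * indicator {0..1} t \<partial>lborel)" for z
  proof (cases "z \<in> ?\<Omega>")
    case True
    define S where "S = power_sum k (2 * m) (($) z)"
    have S: "0 \<le> S" "norm (z $ k) + S < 1" using True by (auto simp: in_ellipsoid_iff S_def power_sum_nonneg)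
    \<comment> \<open>The radius up to which
      \<open>\<zeta> \<mapsto> axis k (z $ k) + \<zeta> *s v\<close> stays in the ellipsoid; for
      \<open>S = 0\<close> it stays there for all \<open>\<zeta>\<close>, and 2 is an arbitrary
      value above 1.\<close>
    define R where "R = (if S = 0 then 2 else ((1 - norm (z $ k)) / S) powr (1 / (2 * m)))"
    have R: "R > 1"
    proof (cases "S = 0")
      case False
      then have "1 < (1 - norm (z $ k)) / S" using S by (simp add: field_simps)
      then show ?thesis using False m by (simp add: R_def)
    qed (simp add: R_def)
    define v where "v = (\<chi> i. if i = k then 0 else z $ i)"
    have inO: "axis k (z $ k) + \<zeta> *s v \<in> ?\<Omega>" if "\<zeta> \<in> ball 0 R" for \<zeta>
    proof -
      have "norm \<zeta> powr (2 * m) * S < 1 - norm (z $ k)"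
      proof (cases "S = 0")
        case False
        then have "norm \<zeta> powr (2 * m) < R powr (2 * m)" using that m by (intro powr_less_mono2) auto
        also have "R powr (2 * m) = (1 - norm (z $ k)) / S"
          using False S m by (simp add: R_def powr_powr)
        finally show ?thesis using False S by (simp add: field_simps)
      qed (use S in auto)
      moreover have "power_sum k (2 * m) (($) (axis k (z $ k) + \<zeta> *s v)) = norm \<zeta> powr (2 * m) * S"
        by (simp add: power_sum_def S_def v_def axis_def norm_mult powr_mult sum_distrib_left)
      ultimately show ?thesis by (simp add: in_ellipsoid_iff v_def)
    qed
    define F where "F = (\<lambda>\<zeta>. f (axis k (z $ k) + \<zeta> *s v))"
    have F: "F holomorphic_on ball 0 R" unfolding F_def by (rule holomorphic_functions_line[OF f]) (use inO in auto)
    have Fe: "F (?e t) = f (circle_action (\<lambda>i. if i = k then 0 else 1) t z)" for t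
      unfolding F_def by (rule arg_cong[of _ _ f]) (auto simp: vec_eq_iff circle_action_def v_def axis_def)
    have "continuous_on {0..1} (\<lambda>t. F (?e t))"
      by (rule continuous_on_compose2[OF holomorphic_on_imp_continuous_on[OF F]])
         (use R in \<open>auto intro!: continuous_intros\<close>)
    then have int: "(\<lambda>t. (norm (F (?e t)))\<^sup>2) integrable_on {0..1}"
      by (intro integrable_continuous_real continuous_intros)
    \<comment> \<open>For \<open>N = 1\<close> Bessel's inequality is the sub-mean-value property of
      \<open>(norm F)\<^sup>2\<close>.\<close>
    have "(norm (F 0))\<^sup>2 \<le> integral {0..1} (\<lambda>t. (norm (F (?e t)))\<^sup>2)"
      using circle_bessel_inequality[OF F R, of 1] by simp
    then have "ennreal ((norm (F 0))\<^sup>2) \<le> ennreal (integral {0..1} (\<lambda>t. (norm (F (?e t)))\<^sup>2))" by (rule ennreal_leI)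
    also have "\<dots> = (\<integral>\<^sup>+t. ennreal ((norm (F (?e t)))\<^sup>2) * indicator {0..1} t \<partial>lborel)"
      using nni[OF _ int] by simp
    finally show ?thesis using True by (simp add: Fe) (simp add: F_def g_def)
  qed simp
  have step2: "ennreal (\<Sum>j<N. (norm (d j))\<^sup>2 * norm (z $ k) ^ (2 * j)) * indicator ?\<Omega> z \<le>
    (\<integral>\<^sup>+t. ennreal ((norm (g (circle_action (\<lambda>i. if i = k then 1 else 0) t z $ k)))\<^sup>2) * indicator ?\<Omega> (circle_action (\<lambda>i. if i = k then 1 else 0) t z) * indicator {0..1} t \<partial>lborel)" for z
  proof (cases "z \<in> ?\<Omega>")
    case True
    define u where "u = z $ k"
    have u: "norm u < 1" using proj[OF True] by (simp add: u_def)
    define R where "R = (if u = 0 then 2 else 1 / norm u)"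
    have R: "R > 1" using u by (simp add: R_def)
    have uR: "u * \<zeta> \<in> ball 0 1" if "\<zeta> \<in> ball 0 R" for \<zeta>
      using that by (auto simp: R_def norm_mult field_simps split: if_splits)
    define F where "F = (\<lambda>\<zeta>. g (u * \<zeta>))"
    have F: "F holomorphic_on ball 0 R"
    proof -
      have "g \<circ> (\<lambda>\<zeta>. u * \<zeta>) holomorphic_on ball 0 R"
        by (rule holomorphic_on_compose_gen[OF _ g]) (use uR in \<open>auto intro!: holomorphic_intros\<close>)
      then show ?thesis by (simp add: F_def comp_def)
    qed
    \<comment> \<open>The coefficients of \<open>F\<close> are those of \<open>g\<close> times
      \<open>u ^ j\<close>, which produces the monomials in \<open>step2\<close>.\<close>
    have dF: "(deriv ^^ j) F 0 = u ^ j * (deriv ^^ j) g 0" for j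
      unfolding F_def using higher_deriv_compose_linear[OF g, of "ball 0 R" 0 u j] R uR by auto
    have "continuous_on {0..1} (\<lambda>t. F (?e t))"
      by (rule continuous_on_compose2[OF holomorphic_on_imp_continuous_on[OF F]])
         (use R in \<open>auto intro!: continuous_intros\<close>)
    then have int: "(\<lambda>t. (norm (F (?e t)))\<^sup>2) integrable_on {0..1}"
      by (intro integrable_continuous_real continuous_intros)
    have "(\<Sum>j<N. (norm (d j))\<^sup>2 * norm u ^ (2 * j)) = (\<Sum>j<N. (norm ((deriv ^^ j) F 0 / fact j))\<^sup>2)"
      by (intro sum.cong refl) (simp add: dF d_def norm_mult norm_divide norm_power power_mult_distrib power_divide power_even_eq)
    also have "\<dots> \<le> integral {0..1} (\<lambda>t. (norm (F (?e t)))\<^sup>2)"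
      by (rule circle_bessel_inequality[OF F R])
    finally have "ennreal (\<Sum>j<N. (norm (d j))\<^sup>2 * norm u ^ (2 * j)) \<le> ennreal (integral {0..1} (\<lambda>t. (norm (F (?e t)))\<^sup>2))" by (rule ennreal_leI)
    also have "\<dots> = (\<integral>\<^sup>+t. ennreal ((norm (F (?e t)))\<^sup>2) * indicator {0..1} t \<partial>lborel)"
      using nni[OF _ int] by simp
    finally have *: "ennreal (\<Sum>j<N. (norm (d j))\<^sup>2 * norm u ^ (2 * j)) \<le> (\<integral>\<^sup>+t. ennreal ((norm (F (?e t)))\<^sup>2) * indicator {0..1} t \<partial>lborel)" .
    have "F (?e t) = g (circle_action (\<lambda>i. if i = k then 1 else 0) t z $ k)" for t
      by (simp add: F_def u_def circle_action_def mult.commute)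
    with * show ?thesis using True by (simp add: u_def)
  qed simp
  have "(\<Sum>j<N. ennreal ((norm (d j))\<^sup>2) * monomial_norm k m j) =
    (\<integral>\<^sup>+z\<in>?\<Omega>. ennreal (\<Sum>j<N. (norm (d j))\<^sup>2 * norm (z $ k) ^ (2 * j)) \<partial>lborel)"
    by (rule sum_monomial_norm[OF m, symmetric]) auto
  \<comment> \<open>Both remaining inequalities integrate a pointwise bound by a circle average and
    then undo the averaging.\<close>
  also have "\<dots> \<le> (\<integral>\<^sup>+z\<in>?\<Omega>. ennreal ((norm (g (z $ k)))\<^sup>2) \<partial>lborel)"
    by (rule order_trans[OF nn_integral_mono[OF step2] eq_refl[OF nn_integral_circle_average[symmetric, OF measurable_indicator_ellipsoid[OF m gc]]]])
  also have "\<dots> \<le> (\<integral>\<^sup>+z\<in>?\<Omega>. ennreal ((norm (f z))\<^sup>2) \<partial>lborel)"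
    by (rule order_trans[OF nn_integral_mono[OF step1] eq_refl[OF nn_integral_circle_average[symmetric, OF measurable_indicator_ellipsoid[OF m fc]]]])
  finally show ?thesis by (simp add: d_def g_def)
qed

text \<open>Averaging over rotations of the coordinate \<open>k\<close> and applying Parseval's
  identity on each circle removes the mixed terms: the powers of \<open>z $ k\<close> are
  orthogonal.\<close>

lemma nn_integral_polynomial_ellipsoid:
  fixes k :: "'n::finite" and d :: "nat \<Rightarrow> complex"
  assumes m: "m > 0"
  shows "(\<integral>\<^sup>+z\<in>ellipsoid k m. ennreal ((norm (\<Sum>j<N. d j * (z $ k) ^ j))\<^sup>2) \<partial>lborel) =
    (\<Sum>j<N. ennreal ((norm (d j))\<^sup>2) * monomial_norm k m j)"
proof -
  let ?\<Omega> = "ellipsoid k m" and ?a = "circle_action (\<lambda>i. if i = k then 1 else 0)"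
  let ?p = "\<lambda>z::complex^'n. \<Sum>j<N. d j * (z $ k) ^ j"
  let ?e = "\<lambda>t::real. exp (2 * of_real pi * \<i> * of_real t) :: complex"
  have "(\<integral>\<^sup>+z\<in>?\<Omega>. ennreal ((norm (?p z))\<^sup>2) \<partial>lborel) =
     (\<integral>\<^sup>+z. (\<integral>\<^sup>+t. ennreal ((norm (?p (?a t z)))\<^sup>2) * indicator ?\<Omega> (?a t z) * indicator {0..1} t \<partial>lborel) \<partial>lborel)"
    by (intro nn_integral_circle_average measurable_indicator_ellipsoid m continuous_intros)
  also have "\<dots> = (\<integral>\<^sup>+z\<in>?\<Omega>. ennreal (\<Sum>j<N. (norm (d j))\<^sup>2 * norm (z $ k) ^ (2 * j)) \<partial>lborel)"
  proof (rule nn_integral_cong)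
    fix z :: "complex ^ 'n"
    have "(\<integral>\<^sup>+t. ennreal ((norm (?p (?a t z)))\<^sup>2) * indicator {0..1} t \<partial>lborel) = ennreal (\<Sum>j<N. (norm (d j * (z $ k) ^ j))\<^sup>2)"
      using nn_integral_has_integral_lebesgue'[OF _ circle_mean_polynomial_norm_square[where d="\<lambda>j. d j * (z $ k) ^ j" and N=N]]
      by (simp add: circle_action_def power_mult_distrib mult_ac)
    also have "(\<Sum>j<N. (norm (d j * (z $ k) ^ j))\<^sup>2) = (\<Sum>j<N. (norm (d j))\<^sup>2 * norm (z $ k) ^ (2 * j))"
      by (simp add: norm_mult norm_power power_mult_distrib power_even_eq)
    finally show "(\<integral>\<^sup>+t. ennreal ((norm (?p (?a t z)))\<^sup>2) * indicator ?\<Omega> (?a t z) * indicator {0..1} t \<partial>lborel) =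
      ennreal (\<Sum>j<N. (norm (d j))\<^sup>2 * norm (z $ k) ^ (2 * j)) * indicator ?\<Omega> z"
      by (cases "z \<in> ?\<Omega>") auto
  qed
  also have "\<dots> = (\<Sum>j<N. ennreal ((norm (d j))\<^sup>2) * monomial_norm k m j)"
    by (rule sum_monomial_norm[OF m]) auto
  finally show ?thesis .
qed

lemma polynomial_in_holomorphic_functions:
  "(\<lambda>z. \<Sum>j<N. d j * (z $ k) ^ j) \<in> holomorphic_functions \<Omega>" for k :: "'n::finite"
  unfolding holomorphic_functions_def
proof (intro CollectI ballI)
  fix z :: "complex ^ 'n"
  let ?P = "\<lambda>u. \<Sum>j<N. d j * u ^ j"
  define c where "c = deriv ?P (z $ k)"
  have "?P holomorphic_on UNIV" by (intro holomorphic_intros)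
  then have "(?P has_field_derivative c) (at (z $ k))"
    unfolding c_def by (rule holomorphic_derivI) auto
  then have P: "(?P has_derivative (*) c) (at (z $ k))" by (simp add: has_field_derivative_def)
  have "((\<lambda>z. z $ k) has_derivative (\<lambda>h. h $ k)) (at z)"
    by (rule bounded_linear.has_derivative[OF bounded_linear_vec_nth has_derivative_ident])
  from has_derivative_compose[OF this P]
  show "\<exists>D. ((\<lambda>z. ?P (z $ k)) has_derivative D) (at z) \<and> (\<forall>c v. D (c *s v) = c * D v)"
    by (intro exI[of _ "\<lambda>h. c * h $ k"]) (auto simp: algebra_simps)
qed

text \<open>From above, the coefficient bound and the Cauchy-Schwarz inequality control the Taylor
  partial sums of any competitor on the axis. From below, normalised truncations of the kernel are
  competitors.\<close>

lemma bergman_kernel_ellipsoid_sums: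
  fixes k :: "'n::finite" and \<gamma> :: "nat \<Rightarrow> real"
  assumes m: "m > 0" and b: "0 < b" "b < 1"
    and \<gamma>: "\<And>j. monomial_norm k m j = ennreal (\<gamma> j)" "\<And>j. 0 < \<gamma> j"
    and K: "(\<lambda>j. b ^ (2 * j) / \<gamma> j) sums K"
  shows "bergman_kernel (ellipsoid k m) (axis k (of_real b)) = ennreal K"
proof (rule antisym)
  let ?\<Omega> = "ellipsoid k m"
  have pos: "0 \<le> b ^ (2 * j) / \<gamma> j" for j using b \<gamma>(2)[of j] by simp
  have partial: "(\<Sum>j<N. b ^ (2 * j) / \<gamma> j) \<le> K" for N
    using sum_le_suminf[of "\<lambda>j. b ^ (2 * j) / \<gamma> j" "{..<N}"] K pos by (auto simp: sums_iff)
  show "bergman_kernel ?\<Omega> (axis k (of_real b)) \<le> ennreal K"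
    unfolding bergman_kernel_def
  proof (rule SUP_least)
    fix f assume "f \<in> {f \<in> holomorphic_functions ?\<Omega>. (\<integral>\<^sup>+z\<in>?\<Omega>. ennreal ((norm (f z))\<^sup>2) \<partial>lebesgue) \<le> 1}"
    then have f: "f \<in> holomorphic_functions ?\<Omega>" and le1: "(\<integral>\<^sup>+z\<in>?\<Omega>. ennreal ((norm (f z))\<^sup>2) \<partial>lborel) \<le> 1"
      by (auto simp: nn_integral_completion)
    define g where "g = (\<lambda>\<zeta>. f (axis k \<zeta>))"
    have ax: "axis k \<zeta> \<in> ?\<Omega>" if "norm \<zeta> < 1" for \<zeta>
      using that m by (simp add: ellipsoid_def axis_def)
    have g: "g holomorphic_on ball 0 1"
    proof -
      have axs: "0 + \<zeta> *s axis k 1 = axis k \<zeta>" for \<zeta> :: complex by (auto simp: vec_eq_iff axis_def)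
      have "(\<lambda>\<zeta>. f (0 + \<zeta> *s axis k 1)) holomorphic_on ball 0 1"
        by (rule holomorphic_functions_line[OF f]) (use ax in \<open>auto simp only: axs mem_ball_0 open_ball\<close>)
      then show ?thesis unfolding axs g_def .
    qed
    define d where "d = (\<lambda>j. (deriv ^^ j) g 0 / fact j)"
    have "(\<lambda>j. d j * of_real b ^ j) sums g (of_real b)"
      using holomorphic_power_series[OF g, of "of_real b"] b by (simp add: d_def)
    then have lim: "(\<lambda>N. (norm (\<Sum>j<N. d j * of_real b ^ j))\<^sup>2) \<longlonglongrightarrow> (norm (g (of_real b)))\<^sup>2"
      unfolding sums_def by (intro tendsto_intros)
    have bound: "(norm (\<Sum>j<N. d j * of_real b ^ j))\<^sup>2 \<le> K" for N
    proof -
      have "ennreal (\<Sum>j<N. (norm (d j))\<^sup>2 * \<gamma> j) = (\<Sum>j<N. ennreal ((norm (d j))\<^sup>2) * monomial_norm k m j)"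
        using \<gamma>(2)[THEN less_imp_le] by (subst sum_ennreal[symmetric]) (auto simp: \<gamma>(1) ennreal_mult)
      also have "\<dots> \<le> 1"
        using bergman_coefficient_bound[OF m f, of N] le1 unfolding d_def g_def by (rule order_trans)
      finally have c1: "(\<Sum>j<N. (norm (d j))\<^sup>2 * \<gamma> j) \<le> 1" by simp
      have "norm (\<Sum>j<N. d j * of_real b ^ j) \<le> (\<Sum>j<N. norm (d j) * b ^ j)"
        using b by (intro order_trans[OF norm_sum]) (simp add: norm_mult norm_power)
      \<comment> \<open>The weights \<open>sqrt (\<gamma> j)\<close> split each term into a factor
        bounded by the norm of \<open>f\<close> and a factor whose squares sum to at most
        \<open>K\<close>.\<close>
      also have "\<dots> = (\<Sum>j<N. (norm (d j) * sqrt (\<gamma> j)) * (b ^ j / sqrt (\<gamma> j)))"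
        using \<gamma>(2) by (intro sum.cong refl) (simp add: less_imp_neq[symmetric])
      finally have "(norm (\<Sum>j<N. d j * of_real b ^ j))\<^sup>2 \<le> (\<Sum>j<N. (norm (d j) * sqrt (\<gamma> j)) * (b ^ j / sqrt (\<gamma> j)))\<^sup>2"
        by (intro power_mono) auto
      also have "\<dots> \<le> (\<Sum>j<N. (norm (d j) * sqrt (\<gamma> j))\<^sup>2) * (\<Sum>j<N. (b ^ j / sqrt (\<gamma> j))\<^sup>2)"
        by (rule Cauchy_Schwarz_ineq_sum)
      also have "(\<Sum>j<N. (norm (d j) * sqrt (\<gamma> j))\<^sup>2) = (\<Sum>j<N. (norm (d j))\<^sup>2 * \<gamma> j)"
        using \<gamma>(2)[THEN less_imp_le] by (simp add: power_mult_distrib)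
      also have "(\<Sum>j<N. (b ^ j / sqrt (\<gamma> j))\<^sup>2) = (\<Sum>j<N. b ^ (2 * j) / \<gamma> j)"
        using \<gamma>(2)[THEN less_imp_le] by (simp add: power_divide power_even_eq)
      also have "(\<Sum>j<N. (norm (d j))\<^sup>2 * \<gamma> j) * (\<Sum>j<N. b ^ (2 * j) / \<gamma> j) \<le> 1 * K"
        using c1 partial[of N] pos by (intro mult_mono sum_nonneg) auto
      finally show ?thesis by simp
    qed
    have "(norm (g (of_real b)))\<^sup>2 \<le> K"
      by (rule LIMSEQ_le_const2[OF lim]) (use bound in auto)
    then show "ennreal ((norm (f (axis k (of_real b))))\<^sup>2) \<le> ennreal K"
      unfolding g_def by (rule ennreal_leI)
  qed
  have lower: "ennreal (\<Sum>j<N. b ^ (2 * j) / \<gamma> j) \<le> bergman_kernel ?\<Omega> (axis k (of_real b))" if N: "N > 0" for N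
  proof -
    define L where "L = (\<Sum>j<N. b ^ (2 * j) / \<gamma> j)"
    have L: "L > 0" unfolding L_def using N b \<gamma>(2) by (intro sum_pos) auto
    \<comment> \<open>Proportional to the coefficients of the truncated kernel at the point.
      Dividing by \<open>sqrt L\<close> gives the polynomial norm 1 and value \<open>sqrt L\<close>
      there; \<open>N > 0\<close> ensures \<open>L > 0\<close>.\<close>
    define d where "d = (\<lambda>j. of_real (b ^ j / (\<gamma> j * sqrt L)) :: complex)"
    define f where "f = (\<lambda>z::complex^'n. \<Sum>j<N. d j * (z $ k) ^ j)"
    have nd: "(norm (d j))\<^sup>2 = b ^ (2 * j) / ((\<gamma> j)\<^sup>2 * L)" for j
      using L b by (simp add: d_def norm_divide norm_mult norm_power power_divide power_mult_distrib power_even_eq)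
    have "(\<integral>\<^sup>+z\<in>?\<Omega>. ennreal ((norm (f z))\<^sup>2) \<partial>lebesgue) = (\<Sum>j<N. ennreal ((norm (d j))\<^sup>2) * ennreal (\<gamma> j))"
      unfolding f_def by (simp add: nn_integral_completion nn_integral_polynomial_ellipsoid[OF m] \<gamma>(1))
    also have "\<dots> = ennreal (\<Sum>j<N. (norm (d j))\<^sup>2 * \<gamma> j)"
      using \<gamma>(2)[THEN less_imp_le] by (subst sum_ennreal[symmetric]) (auto simp: ennreal_mult)
    also have "(\<Sum>j<N. (norm (d j))\<^sup>2 * \<gamma> j) = (\<Sum>j<N. (b ^ (2 * j) / \<gamma> j) / L)"
    proof (intro sum.cong refl)
      fix j show "(norm (d j))\<^sup>2 * \<gamma> j = (b ^ (2 * j) / \<gamma> j) / L"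
        unfolding nd using \<gamma>(2)[of j] L by (simp add: power2_eq_square)
    qed
    also have "\<dots> = L / L" unfolding L_def by (rule sum_divide_distrib[symmetric])
    also have "\<dots> = 1" using L by simp
    finally have n1: "(\<integral>\<^sup>+z\<in>?\<Omega>. ennreal ((norm (f z))\<^sup>2) \<partial>lebesgue) \<le> 1" by simp
    have "f (axis k (of_real b)) = of_real (\<Sum>j<N. (b ^ (2 * j) / \<gamma> j) / sqrt L)"
      unfolding f_def d_def by (simp add: power_even_eq power2_eq_square)
    also have "(\<Sum>j<N. (b ^ (2 * j) / \<gamma> j) / sqrt L) = L / sqrt L"
      unfolding L_def by (rule sum_divide_distrib[symmetric])
    finally have "(norm (f (axis k (of_real b))))\<^sup>2 = L"
      using L by (simp add: power_divide norm_divide real_div_sqrt)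
    moreover have "f \<in> holomorphic_functions ?\<Omega>" unfolding f_def by (rule polynomial_in_holomorphic_functions)
    ultimately show ?thesis unfolding bergman_kernel_def L_def[symmetric]
      using n1 by (intro SUP_upper2[of f]) auto
  qed
  have "(\<lambda>N. ennreal (\<Sum>j<N. b ^ (2 * j) / \<gamma> j)) \<longlonglongrightarrow> ennreal K"
    using K unfolding sums_def by (rule tendsto_ennrealI)
  then show "ennreal K \<le> bergman_kernel ?\<Omega> (axis k (of_real b))"
    by (rule LIMSEQ_le_const2) (use lower in \<open>auto intro!: exI[of _ 1]\<close>)
qed

section \<open>Closed form of the kernel on the axis\<close>

lemma monomial_norm_Beta:
  fixes k :: "'n::finite"
  assumes n: "CARD('n) \<ge> 2" and m: "m > 0" and a: "a = (real CARD('n) - 1) / m + 2"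
  shows "monomial_norm k m j = fibre_volume k (2 * m) 1 * ennreal (2 * pi * Beta (2 * real j + 2) (a - 1))"
proof -
  let ?V = "fibre_volume k (2 * m) 1"
  have a2: "a > 2" using n m by (simp add: a)
  have q: "2 * (real CARD('n) - 1) / (2 * m) = a - 2" using m unfolding a by (subst mult_divide_mult_cancel_left) auto
  define G :: "complex \<Rightarrow> real \<Rightarrow> ennreal" where "G = (\<lambda>u s. ennreal (norm u ^ (2 * j)) * indicator {(u, s). norm u + s < 1} (u, s))"
  have G: "case_prod G \<in> borel_measurable (borel \<Otimes>\<^sub>M borel)"
    unfolding G_def by measurable
  have "monomial_norm k m j = (\<integral>\<^sup>+z. G (z $ k) (power_sum k (2 * m) (($) z)) \<partial>lborel)"
    unfolding monomial_norm_def by (intro nn_integral_cong) (auto simp: G_def indicator_def in_ellipsoid_iff)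
  also have "\<dots> = (\<integral>\<^sup>+u. (\<integral>\<^sup>+f. G u (power_sum k (2 * m) f) \<partial>fibre_measure k) \<partial>lborel)"
    by (rule nn_integral_coordinate_power_sum[OF G])
  also have "\<dots> = (\<integral>\<^sup>+u. ?V * (ennreal (norm (u::complex) ^ (2 * j) * (1 - norm u) powr (a - 2)) * indicator {..<1} (norm u)) \<partial>lborel)"
  proof (intro nn_integral_cong)
    fix u :: complex
    let ?A = "{f \<in> space (fibre_measure k). power_sum k (2 * m) f < 1 - norm u}"
    have "(\<integral>\<^sup>+f. G u (power_sum k (2 * m) f) \<partial>fibre_measure k) =
      (\<integral>\<^sup>+f. ennreal (norm u ^ (2 * j)) * indicator ?A f \<partial>fibre_measure k)"
      by (intro nn_integral_cong) (auto simp: G_def indicator_def)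
    also have "\<dots> = ennreal (norm u ^ (2 * j)) * emeasure (fibre_measure k) ?A"
      by (intro nn_integral_cmult_indicator) measurable
    also have "\<dots> = ?V * (ennreal (norm u ^ (2 * j) * (1 - norm u) powr (a - 2)) * indicator {..<1} (norm u))"
    proof (cases "norm u < 1")
      case True
      then show ?thesis
        using emeasure_power_sum_less[of "1 - norm u" "2 * m" k] m unfolding q by (simp add: ennreal_mult mult_ac)
    next
      case False
      then have "\<not> power_sum k (2 * m) f < 1 - norm u" for f using power_sum_nonneg[of k "2 * m" f] by linarith
      then show ?thesis using False by simp
    qed
    finally show "(\<integral>\<^sup>+f. G u (power_sum k (2 * m) f) \<partial>fibre_measure k) =
      ?V * (ennreal (norm u ^ (2 * j) * (1 - norm u) powr (a - 2)) * indicator {..<1} (norm u))" .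
  qed
  also have "\<dots> = (\<integral>\<^sup>+r. ?V * (ennreal (r ^ (2 * j) * (1 - r) powr (a - 2)) * indicator {..<1} r) * ennreal (2 * pi * r) * indicator {0..} r \<partial>lborel)"
    by (rule nn_integral_complex_radial) measurable
  also have "\<dots> = (\<integral>\<^sup>+r. ?V * (ennreal (2 * pi * (r powr (2 * real j + 2 - 1) * (1 - r) powr (a - 1 - 1))) * indicator {0..1} r) \<partial>lborel)"
  proof (rule nn_integral_cong)
    fix r :: real
    \<comment> \<open>The polar factor \<open>r\<close> raises the exponent to
      \<open>2 * j + 1\<close>. At \<open>r = 0\<close> and \<open>r = 1\<close> the Beta integrand
      vanishes because \<open>0 powr x = 0\<close>, so the integrands agree at every
      \<open>r\<close>.\<close>
    consider "r < 0" | "r = 0" | "0 < r" "r < 1" | "r = 1" | "r > 1" by linarith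
    then show "?V * (ennreal (r ^ (2 * j) * (1 - r) powr (a - 2)) * indicator {..<1} r) * ennreal (2 * pi * r) * indicator {0..} r =
      ?V * (ennreal (2 * pi * (r powr (2 * real j + 2 - 1) * (1 - r) powr (a - 1 - 1))) * indicator {0..1} r)"
    proof cases
      case 3
      have "r powr (2 * real j + 2 - 1) = r ^ (2 * j) * r"
        using 3 powr_realpow[of r "2 * j + 1"] by (simp add: add.commute)
      then have e: "ennreal (r ^ (2 * j) * (1 - r) powr (a - 2)) * ennreal (2 * pi * r) =
          ennreal (2 * pi * (r powr (2 * real j + 2 - 1) * (1 - r) powr (a - 1 - 1)))"
        using 3 by (subst ennreal_mult[symmetric]) (simp_all add: mult_ac)
      have i: "indicator {..<1} r = (1::ennreal)" "indicator {0..} r = (1::ennreal)" "indicator {0..1} r = (1::ennreal)"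
        using 3 by auto
      show ?thesis unfolding i mult_1_right by (simp only: mult.assoc[of ?V] e)
    qed auto
  qed
  also have "\<dots> = ?V * (\<integral>\<^sup>+r. ennreal (2 * pi * (r powr (2 * real j + 2 - 1) * (1 - r) powr (a - 1 - 1))) * indicator {0..1} r \<partial>lborel)"
    by (rule nn_integral_cmult) measurable
  also have "(\<integral>\<^sup>+r. ennreal (2 * pi * (r powr (2 * real j + 2 - 1) * (1 - r) powr (a - 1 - 1))) * indicator {0..1} r \<partial>lborel) =
     ennreal (2 * pi * Beta (2 * real j + 2) (a - 1))"
    by (rule nn_integral_has_integral_lebesgue'[OF _ has_integral_mult_right[OF has_integral_Beta_real]]) (use a2 in auto)
  finally show ?thesis .
qed

text \<open>The reciprocal of \<open>Beta (2 * j + 2) (a - 1)\<close> is \<open>a - 1\<close> times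
  the coefficient of \<open>x ^ (2 * j + 1)\<close> in \<open>(1 - x) powr (- a)\<close>. The sum is
  thus the odd part of a binomial series, divided by \<open>b\<close>.\<close>

lemma Beta_odd_reciprocal_sums:
  assumes b: "0 < b" "b < 1" and a: "a > 1"
  shows "(\<lambda>j. b ^ (2 * j) / Beta (2 * real j + 2) (a - 1)) sums
    ((a - 1) / (2 * b) * ((1 - b) powr (- a) - (1 + b) powr (- a)))"
proof -
  define c where "c = (\<lambda>n. pochhammer a n / fact n)"
  have c: "((- a) gchoose n) = (- 1) ^ n * c n" for n
    by (simp add: gbinomial_pochhammer c_def)
  have "(\<lambda>n. ((- a) gchoose n) * (- b) ^ n) sums (1 + (- b)) powr (- a)"
    by (rule gen_binomial_real) (use b in auto)
  moreover have "(\<lambda>n. ((- a) gchoose n) * b ^ n) sums (1 + b) powr (- a)"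
    by (rule gen_binomial_real) (use b in auto)
  ultimately have "(\<lambda>n. ((- a) gchoose n) * (- b) ^ n - ((- a) gchoose n) * b ^ n) sums ((1 + (- b)) powr (- a) - (1 + b) powr (- a))"
    by (rule sums_diff)
  moreover have "((- a) gchoose n) * (- b) ^ n - ((- a) gchoose n) * b ^ n = (if odd n then 2 * c n * b ^ n else 0)" for n
    by (simp add: c)
  ultimately have "(\<lambda>n. if odd n then 2 * c n * b ^ n else 0) sums ((1 - b) powr (- a) - (1 + b) powr (- a))"
    by simp
  \<comment> \<open>The even terms cancelled in the difference, so the series can be reindexed along
    the odd numbers.\<close>
  then have "(\<lambda>j. if odd (2 * j + 1) then 2 * c (2 * j + 1) * b ^ (2 * j + 1) else 0) sums ((1 - b) powr (- a) - (1 + b) powr (- a))"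
    by (subst sums_mono_reindex[of "\<lambda>j. 2 * j + 1" "\<lambda>n. if odd n then 2 * c n * b ^ n else 0"])
       (auto simp: strict_mono_def elim!: oddE)
  then have "(\<lambda>j. (a - 1) / (2 * b) * (2 * c (2 * j + 1) * b ^ (2 * j + 1))) sums ((a - 1) / (2 * b) * ((1 - b) powr (- a) - (1 + b) powr (- a)))"
    by (intro sums_mult) simp
  moreover have "(a - 1) / (2 * b) * (2 * c (2 * j + 1) * b ^ (2 * j + 1)) = b ^ (2 * j) / Beta (2 * real j + 2) (a - 1)" for j
  proof -
    have G: "Gamma a = (a - 1) * Gamma (a - 1)"
      using Gamma_plus1[of "a - 1"] a nonpos_Ints_nonpos[of "a - 1"] by fastforce
    have "a \<notin> \<int>\<^sub>\<le>\<^sub>0" using a by (auto dest: nonpos_Ints_nonpos)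
    then have "pochhammer a (2 * j + 1) = Gamma (a + real (2 * j + 1)) / Gamma a"
      by (rule pochhammer_Gamma)
    moreover have "fact (2 * j + 1) = Gamma (2 * real j + 2)"
      using Gamma_fact[of "2 * j + 1", where 'a=real] by (simp add: add_ac)
    moreover have "a + real (2 * j + 1) = 2 * real j + 2 + (a - 1)" by simp
    ultimately have "c (2 * j + 1) = Gamma (2 * real j + 2 + (a - 1)) / (Gamma a * Gamma (2 * real j + 2))"
      by (simp only: c_def) simp
    then show ?thesis using a b Gamma_real_pos[of "a - 1"] by (simp add: Beta_def G mult_ac)
  qed
  ultimately show ?thesis by simp
qed

lemma bergman_kernel_ellipsoid:
  fixes k :: "'n::finite"
  assumes n: "CARD('n) \<ge> 2" and m: "m > 0" and b: "0 < b" "b < 1"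
    and a: "a = (real CARD('n) - 1) / m + 2"
    and C: "fibre_volume k (2 * m) 1 = ennreal C" "C > 0"
  shows "bergman_kernel (ellipsoid k m) (axis k (of_real b)) =
    ennreal ((a - 1) / (4 * pi * b * C) * ((1 - b) powr (- a) - (1 + b) powr (- a)))"
proof (rule bergman_kernel_ellipsoid_sums[OF m b])
  have a2: "a > 2" using n m by (simp add: a)
  have Bpos: "0 < Beta (2 * real j + 2) (a - 1)" for j
    using a2 by (simp add: Beta_def Gamma_real_pos)
  show "monomial_norm k m j = ennreal (C * (2 * pi * Beta (2 * real j + 2) (a - 1)))" for j
    using C Bpos[of j] by (subst monomial_norm_Beta[OF n m a]) (simp add: ennreal_mult)
  show "0 < C * (2 * pi * Beta (2 * real j + 2) (a - 1))" for j
    using C Bpos[of j] by simp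
  have "(\<lambda>j. b ^ (2 * j) / Beta (2 * real j + 2) (a - 1) / (2 * pi * C)) sums
    ((a - 1) / (2 * b) * ((1 - b) powr (- a) - (1 + b) powr (- a)) / (2 * pi * C))"
    by (intro sums_divide Beta_odd_reciprocal_sums b) (use a2 in simp)
  then show "(\<lambda>j. b ^ (2 * j) / (C * (2 * pi * Beta (2 * real j + 2) (a - 1)))) sums
    ((a - 1) / (4 * pi * b * C) * ((1 - b) powr (- a) - (1 + b) powr (- a)))"
    by (simp add: mult_ac)
qed

theorem theorem6:
  fixes n :: nat and k :: "'n::finite" and m a b :: real
    and \<Omega> :: "(complex ^ 'n) set" and w :: "complex ^ 'n"
  assumes "CARD('n) = n" and "n \<ge> 2" and "m \<ge> 1/2"
    and "\<Omega> = ellipsoid k m"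
    and "0 < b" and "b < 1"
    and "w = axis k (complex_of_real b)"
    and "a = (real n - 1) / m + 2"
  shows "bergman_kernel \<Omega> w * emeasure lebesgue (kobayashi_indicatrix \<Omega> w)
    = ennreal (1 + (1 - b) powr a *
        (((1 + b) powr a - (1 - b) powr a - 2 * a * b) / (2 * a * b * (1 + b) powr a)))"
proof -
  have n: "CARD('n) \<ge> 2" and a: "a = (real CARD('n) - 1) / m + 2" and m: "m > 0" and b: "0 < b" "b < 1"
    using assms by auto
  have a2: "a > 2" using n m by (simp add: a)
  \<comment> \<open>The fibre volume is finite and positive, hence a real number that may be divided
    by; its value is never computed.\<close>
  define C where "C = enn2real (fibre_volume k (2 * m) 1)"
  have fin: "fibre_volume k (2 * m) 1 < \<infinity>" using m by (intro fibre_volume_finite) simp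
  have C: "fibre_volume k (2 * m) 1 = ennreal C" using fin by (simp add: C_def)
  have "0 < fibre_volume k (2 * m) 1" using m by (intro fibre_volume_pos) simp
  then have C0: "C > 0" using C by simp
  define p where "p = (1 - b) powr a"
  define q where "q = (1 + b) powr a"
  have p: "p > 0" and q: "q > 0" using b by (simp_all add: p_def q_def)
  have pq: "p < q" unfolding p_def q_def using b a2 by (intro powr_less_mono2) auto
  have inv: "(1 - b) powr (- a) = 1 / p" "(1 + b) powr (- a) = 1 / q"
    by (simp_all add: p_def q_def powr_minus_divide)
  have "bergman_kernel \<Omega> w * emeasure lebesgue (kobayashi_indicatrix \<Omega> w) =
    ennreal ((a - 1) / (4 * pi * b * C) * (1 / p - 1 / q)) * (ennreal C * ennreal (2 * pi * (p * (2 * a * b + p) / (a * (a - 1)))))"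
    using bergman_kernel_ellipsoid[OF n m b a C C0] emeasure_kobayashi_indicatrix[OF n assms(3) b a, of k]
    by (simp only: assms(4,7) inv C p_def[symmetric])
  \<comment> \<open>Merging the products in \<open>ennreal\<close> requires nonnegative factors; for
    the kernel this is \<open>p < q\<close>.\<close>
  also have "\<dots> = ennreal ((a - 1) / (4 * pi * b * C) * (1 / p - 1 / q) * (C * (2 * pi * (p * (2 * a * b + p) / (a * (a - 1))))))"
  proof -
    have "0 \<le> 1 / p - 1 / q" using p q pq by (simp add: frac_le)
    then have A: "0 \<le> (a - 1) / (4 * pi * b * C) * (1 / p - 1 / q)" using a2 b C0 by simp
    have B: "0 \<le> 2 * pi * (p * (2 * a * b + p) / (a * (a - 1)))" using a2 b p by simp
    have "0 \<le> C * (2 * pi * (p * (2 * a * b + p) / (a * (a - 1))))" by (rule mult_nonneg_nonneg[OF less_imp_le[OF C0] B])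
    then show ?thesis by (simp only: ennreal_mult[OF A] ennreal_mult[OF less_imp_le[OF C0] B])
  qed
  \<comment> \<open>The fibre volume, \<open>pi\<close> and \<open>a - 1\<close> cancel, leaving an
    identity in \<open>p\<close>, \<open>q\<close>, \<open>a\<close> and \<open>b\<close>.\<close>
  also have "(a - 1) / (4 * pi * b * C) * (1 / p - 1 / q) * (C * (2 * pi * (p * (2 * a * b + p) / (a * (a - 1))))) =
     1 + p * ((q - p - 2 * a * b) / (2 * a * b * q))"
  proof -
    have "(a - 1) / (4 * pi * b * C) * (1 / p - 1 / q) * (C * (2 * pi * (p * (2 * a * b + p) / (a * (a - 1))))) =
      (1 / p - 1 / q) * p * (2 * a * b + p) / (2 * a * b)"
      using a2 b C0 by (simp add: divide_simps)
    also have "(1 / p - 1 / q) * p = (q - p) / q" using p q by (simp add: field_simps)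
    also have "(q - p) / q * (2 * a * b + p) / (2 * a * b) = 1 + p * ((q - p - 2 * a * b) / (2 * a * b * q))"
      using a2 b q by (simp add: field_simps)
    finally show ?thesis .
  qed
  finally show ?thesis by (simp add: p_def q_def)
qed

end
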